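(* Let $\{\mathcal{A}_k\}_{k=1}^{\infty}$ be a sequence of labyrinth patterns with widths $m_k\ge 3$ for all $k\ge 1$. Then the limit set $L_{\infty}$ defined by the sequence $\{\mathcal{A}_k\}_{k=1}^{\infty}$ is a dendrite.
   Context: Patterns. For an integer $m\ge 1$ let $S_{i,j,m}=\{(x,y)\mid \frac{i}{m}\le x\le \frac{i+1}{m},\ \frac{j}{m}\le y\le\frac{j+1}{m}\}$ and $\mathcal{S}_m=\{S_{i,j,m}\mid 0\le i\le m-1,\ 0\le j\le m-1\}$. A nonempty subset $\mathcal{A}\subseteq\mathcal{S}_m$ is called an $m$-pattern of width $m$; its elements are called its white squares. Graph, exits. $\mathcal{G}(\mathcal{A})$ is the graph whose vertices are the white squares of $\mathcal{A}$ and whose edges are the unordered pairs of distinct white squares having a common side. The top (bottom) row of $\mathcal{A}$ is the set of white squares $S_{i,j,m}\in\mathcal{A}$ with $j=m-1$ ($j=0$); the left (right) column is the set of those with $i=0$ ($i=m-1$). A top exit is a white square in the top row such that there is a white square in the same column in the bottom row, the latter being the corresponding bottom exit; together they form a vertical exit pair. A left exit is a white square in the left column such that there is a white square in the same row in the right column, the latter being the corresponding right exit; together they form a horizontal exit pair. Labyrinth pattern. An $m$-pattern $\mathcal{A}$ with $m\ge 3$ is a labyrinth pattern if: (1) $\mathcal{G}(\mathcal{A})$ is a tree; (2) $\mathcal{A}$ has exactly one vertical exit pair and exactly one horizontal exit pair; (3) if there is a white square in $\mathcal{A}$ at a corner of the unit square (one of $S_{0,0,m},S_{m-1,0,m},S_{0,m-1,m},S_{m-1,m-1,m}$),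 then there is no white square in $\mathcal{A}$ at the diagonally opposite corner. Iterative construction. For a square $Q=[x,x+q]\times[y,y+q]\subseteq[0,1]^2$ put $P_Q(z_x,z_y)=(qz_x+x,\,qz_y+y)$. Given a sequence of patterns $\mathcal{A}_k\subseteq\mathcal{S}_{m_k}$, let $\mathcal{W}_1=\mathcal{A}_1$ and, for $n\ge 2$, $\mathcal{W}_n=\{P_{V}(W)\mid W\in\mathcal{A}_n,\ V\in\mathcal{W}_{n-1}\}$. Let $L_n=\bigcup_{W\in\mathcal{W}_n}W$ and $L_\infty=\bigcap_{n\ge 1}L_n$, the limit set defined by the sequence. A continuum is a compact connected Hausdorff space; a dendrite is a locally connected continuum that contains no simple closed curve. *)

theory Defs
  imports "HOL-Analysis.Analysis"
begin

text \<open>The second component holds the edges, as unordered pairs of distinct vertices.\<close>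

type_synonym 'a ugraph = "'a set \<times> 'a set set"

definition ugraph_connected :: "'a ugraph \<Rightarrow> bool" where
  "ugraph_connected G \<longleftrightarrow>
     fst G \<noteq> {} \<and> (\<forall>u\<in>fst G. \<forall>v\<in>fst G. (u, v) \<in> {(x, y). {x, y} \<in> snd G}\<^sup>*)"

text \<open>A cycle is given by the list of its pairwise distinct vertices, without repeating the first
  one at the end.\<close>

definition ugraph_cycle :: "'a ugraph \<Rightarrow> 'a list \<Rightarrow> bool" where
  "ugraph_cycle G xs \<longleftrightarrow>
     3 \<le> length xs \<and> distinct xs \<and> set xs \<subseteq> fst G \<and>
     (\<forall>i<length xs. {xs ! i, xs ! (Suc i mod length xs)} \<in> snd G)"

definition ugraph_tree :: "'a ugraph \<Rightarrow> bool" where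
  "ugraph_tree G \<longleftrightarrow> ugraph_connected G \<and> (\<nexists>xs. ugraph_cycle G xs)"

type_synonym plane = "real \<times> real"

definition grid_square :: "nat \<Rightarrow> nat \<Rightarrow> nat \<Rightarrow> plane set" where
  "grid_square i j m =
     {(x, y). real i / real m \<le> x \<and> x \<le> (real i + 1) / real m \<and>
              real j / real m \<le> y \<and> y \<le> (real j + 1) / real m}"

definition grid_squares :: "nat \<Rightarrow> plane set set" where
  "grid_squares m = {grid_square i j m | i j. i < m \<and> j < m}"

definition pattern :: "nat \<Rightarrow> plane set set \<Rightarrow> bool" where
  "pattern m A \<longleftrightarrow> 1 \<le> m \<and> A \<subseteq> grid_squares m \<and> A \<noteq> {}"

text \<open>The four sides (left, right, bottom, top) of \<^term>\<open>grid_square i j m\<close>.\<close>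

definition grid_sides :: "nat \<Rightarrow> nat \<Rightarrow> nat \<Rightarrow> plane set set" where
  "grid_sides i j m =
     (let l = real i / real m; r = (real i + 1) / real m;
          b = real j / real m; t = (real j + 1) / real m
      in {{l} \<times> {b..t}, {r} \<times> {b..t}, {l..r} \<times> {b}, {l..r} \<times> {t}})"

definition pattern_graph :: "nat \<Rightarrow> plane set set \<Rightarrow> plane set ugraph" where
  "pattern_graph m A =
     (A, {{grid_square i j m, grid_square k l m} | i j k l.
            i < m \<and> j < m \<and> k < m \<and> l < m \<and>
            grid_square i j m \<in> A \<and> grid_square k l m \<in> A \<and>
            grid_square i j m \<noteq> grid_square k l m \<and>
            grid_sides i j m \<inter> grid_sides k l m \<noteq> {}})"

text \<open>Pairs (top exit, bottom exit) and (left exit, right exit).\<close>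

definition vertical_exit_pairs :: "nat \<Rightarrow> plane set set \<Rightarrow> (plane set \<times> plane set) set" where
  "vertical_exit_pairs m A =
     {(grid_square i (m - 1) m, grid_square i 0 m) | i.
        i < m \<and> grid_square i (m - 1) m \<in> A \<and> grid_square i 0 m \<in> A}"

definition horizontal_exit_pairs :: "nat \<Rightarrow> plane set set \<Rightarrow> (plane set \<times> plane set) set" where
  "horizontal_exit_pairs m A =
     {(grid_square 0 j m, grid_square (m - 1) j m) | j.
        j < m \<and> grid_square 0 j m \<in> A \<and> grid_square (m - 1) j m \<in> A}"

definition labyrinth_pattern :: "nat \<Rightarrow> plane set set \<Rightarrow> bool" where
  "labyrinth_pattern m A \<longleftrightarrow>
     pattern m A \<and> 3 \<le> m \<and>
     ugraph_tree (pattern_graph m A) \<and>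
     (\<exists>!p. p \<in> vertical_exit_pairs m A) \<and>
     (\<exists>!p. p \<in> horizontal_exit_pairs m A) \<and>
     (\<forall>i\<in>{0, m - 1}. \<forall>j\<in>{0, m - 1}.
        grid_square i j m \<in> A \<longrightarrow> grid_square (m - 1 - i) (m - 1 - j) m \<notin> A)"

definition square :: "real \<Rightarrow> real \<Rightarrow> real \<Rightarrow> plane set" where
  "square x y q = {x..x + q} \<times> {y..y + q}"

text \<open>The map \<open>P\<^sub>Q\<close> for \<open>Q = square x y q\<close>; the parameters are determined by \<open>Q\<close> when \<open>0 < q\<close>.\<close>

definition square_map :: "real \<Rightarrow> real \<Rightarrow> real \<Rightarrow> plane \<Rightarrow> plane" where
  "square_map x y q = (\<lambda>(zx, zy). (q * zx + x, q * zy + y))"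

text \<open>Sequences are indexed from 1; the value at index 0 is a dummy that is never used.\<close>

fun white_squares :: "(nat \<Rightarrow> plane set set) \<Rightarrow> nat \<Rightarrow> plane set set" where
  "white_squares A 0 = {}"
| "white_squares A (Suc 0) = A 1"
| "white_squares A (Suc (Suc n)) =
     {square_map x y q ` W | W x y q.
        W \<in> A (Suc (Suc n)) \<and> 0 < q \<and> square x y q \<in> white_squares A (Suc n)}"

definition level_set :: "(nat \<Rightarrow> plane set set) \<Rightarrow> nat \<Rightarrow> plane set" where
  "level_set A n = \<Union> (white_squares A n)"

definition limit_set :: "(nat \<Rightarrow> plane set set) \<Rightarrow> plane set" where
  "limit_set A = (\<Inter>n\<in>{1..}. level_set A n)"

definition continuum :: "'a topology \<Rightarrow> bool" where
  "continuum X \<longleftrightarrow> compact_space X \<and> connected_space X \<and> Hausdorff_space X"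

definition simple_closed_curve_in :: "'a topology \<Rightarrow> 'a set \<Rightarrow> bool" where
  "simple_closed_curve_in X C \<longleftrightarrow>
     C \<subseteq> topspace X \<and> subtopology X C homeomorphic_space top_of_set (sphere (0::complex) 1)"

definition dendrite :: "'a topology \<Rightarrow> bool" where
  "dendrite X \<longleftrightarrow>
     continuum X \<and> locally_connected_space X \<and> (\<nexists>C. simple_closed_curve_in X C)"

end

theory Submission
  imports Defs
begin

text \<open>Splitting off the first pattern writes the limit set as a finite union of scaled copies of the limit
  set of the shifted sequence. Copies in adjacent white squares meet, because of the exits, and in a single
  point, because the exit pairs are unique; copies in other squares are disjoint, because opposite corners
  are never both white. Connectedness, and local connectedness by way of arbitrarily small connected pieces,
  follow from the connectedness of the graphs.

  For the absence of simple closed curves it is enough that the complement of the limit set is connected and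
  dense: then the complement of every subset of the limit set is connected, contradicting the Jordan curve
  theorem. Density holds because every pattern has a black corner. For connectedness take two points outside
  the \<open>n\<close>-th level set and induct on \<open>n\<close>: no single copy separates them, and adding the copies along the
  tree, one leaf at a time, Janiszewski's theorem shows that their union does not separate them either.\<close>

section \<open>Forests\<close>

text \<open>Cycles are encoded as in \<open>ugraph_cycle\<close>, so that a cycle of cells becomes a
  cycle of squares by mapping the list.\<close>

definition cycle_free :: "('v \<Rightarrow> 'v \<Rightarrow> bool) \<Rightarrow> 'v set \<Rightarrow> bool" where
  "cycle_free E S \<longleftrightarrow>
     (\<nexists>xs. 3 \<le> length xs \<and> distinct xs \<and> set xs \<subseteq> S \<and>
           (\<forall>i<length xs. E (xs ! i) (xs ! (Suc i mod length xs))))"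

lemma cycle_free_subset: "cycle_free E S \<Longrightarrow> T \<subseteq> S \<Longrightarrow> cycle_free E T"
  unfolding cycle_free_def by (meson order_trans)

text \<open>The first vertex of a longest path is a leaf or isolated: a neighbour off the path would
  extend it, and a neighbour further along than the second vertex would close a cycle. The vertex
  \<open>u\<close> is not claimed to lie in \<open>S\<close>.\<close>

lemma cycle_free_leaf:
  assumes "finite S" "S \<noteq> {}" and sym: "\<And>v w. E v w \<Longrightarrow> E w v" and "cycle_free E S"
  obtains v u where "v \<in> S" "\<And>w. w \<in> S \<Longrightarrow> w \<noteq> v \<Longrightarrow> E v w \<Longrightarrow> w = u"
proof -
  define path where "path xs \<longleftrightarrow> xs \<noteq> [] \<and> distinct xs \<and> set xs \<subseteq> S \<and>
    (\<forall>i. Suc i < length xs \<longrightarrow> E (xs ! i) (xs ! Suc i))" for xs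
  have "length xs < Suc (card S)" if "path xs" for xs
    using that card_mono[OF \<open>finite S\<close>, of "set xs"] by (simp add: path_def distinct_card)
  moreover obtain s where "s \<in> S" using \<open>S \<noteq> {}\<close> by blast
  then have "path [s]" by (simp add: path_def)
  ultimately obtain xs where xs: "path xs" and longest: "\<And>ys. path ys \<Longrightarrow> length ys \<le> length xs"
    using ex_has_greatest_nat[of path "[s]" length "Suc (card S)"] by (metis less_imp_le)
  have ne: "xs \<noteq> []" using xs by (simp add: path_def)
  show ?thesis
  proof (rule that)
    show "xs ! 0 \<in> S" using xs ne unfolding path_def by (meson length_greater_0_conv nth_mem subsetD)
    fix w assume w: "w \<in> S" "w \<noteq> xs ! 0" "E (xs ! 0) w"
    \<comment> \<open>For a path with one vertex \<open>xs ! 1\<close> is an unspecified value. This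
      is harmless: a neighbour \<open>w\<close> other than \<open>xs ! 0\<close> cannot exist then,
      since \<open>w\<close> must lie on the path.\<close>
    show "w = xs ! 1"
    proof (rule ccontr)
      assume "w \<noteq> xs ! 1"
      have "w \<in> set xs"
      proof (rule ccontr)
        assume "w \<notin> set xs"
        then have "path (w # xs)"
          using xs w sym unfolding path_def by (auto simp: nth_Cons split: nat.splits)
        then show False using longest by fastforce
      qed
      then obtain k where k: "k < length xs" "w = xs ! k" by (metis in_set_conv_nth)
      with w \<open>w \<noteq> xs ! 1\<close> have "2 \<le> k"
        by (metis One_nat_def Suc_1 less_2_cases not_less)
      \<comment> \<open>The initial segment of the path up to \<open>w\<close>, closed by the edge
        from \<open>w\<close> back to \<open>xs ! 0\<close>, has \<open>k + 1\<close> vertices,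
        hence at least 3.\<close>
      let ?ys = "take (Suc k) xs"
      have len: "length ?ys = Suc k" using k by simp
      have "E (?ys ! i) (?ys ! (Suc i mod length ?ys))" if "i < length ?ys" for i
      proof (cases "i = k")
        case True
        then show ?thesis using len w k sym by simp
      next
        case False
        with that len have "i < k" by simp
        then show ?thesis using len xs k unfolding path_def by simp
      qed
      moreover have "distinct ?ys" "set ?ys \<subseteq> S"
        using xs set_take_subset[of "Suc k" xs] unfolding path_def by auto
      ultimately show False
        using \<open>cycle_free E S\<close> len \<open>2 \<le> k\<close> unfolding cycle_free_def by (metis Suc_le_mono numeral_2_eq_2 numeral_3_eq_3)
    qed
  qed
qed

text \<open>Induction removing a leaf \<open>v\<close>: the piece \<open>K v\<close> meets the union
  of the others only inside the piece of its one neighbour, so this intersection is connected.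
  Janiszewski's theorem then says that the two sets together do not separate \<open>x\<close> from
  \<open>y\<close> if neither does alone.\<close>

lemma forest_not_separating:
  fixes K :: "'v \<Rightarrow> complex set"
  assumes "finite S" "cycle_free E S" and sym: "\<And>v w. E v w \<Longrightarrow> E w v"
    and "\<And>v. v \<in> S \<Longrightarrow> compact (K v)"
    and "\<And>v. v \<in> S \<Longrightarrow> connected_component (- K v) x y"
    and "\<And>v w. \<lbrakk>v \<in> S; w \<in> S; v \<noteq> w\<rbrakk> \<Longrightarrow> connected (K v \<inter> K w)"
    and "\<And>v w. \<lbrakk>v \<in> S; w \<in> S; v \<noteq> w; \<not> E v w\<rbrakk> \<Longrightarrow> K v \<inter> K w = {}"
  shows "connected_component (- (\<Union>v\<in>S. K v)) x y"
  using assms(1,2,4-)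
proof (induction "card S" arbitrary: S)
  case 0
  then show ?case by (simp add: connected_component_def) (meson UNIV_I connected_UNIV)
next
  case (Suc n)
  then have "S \<noteq> {}" by auto
  obtain v u where v: "v \<in> S" and leaf: "\<And>w. w \<in> S \<Longrightarrow> w \<noteq> v \<Longrightarrow> E v w \<Longrightarrow> w = u"
    using cycle_free_leaf[OF Suc.prems(1) \<open>S \<noteq> {}\<close> sym Suc.prems(2)] by metis
  let ?T = "S - {v}"
  have IH: "connected_component (- (\<Union>w\<in>?T. K w)) x y"
  proof (rule Suc.hyps(1))
    show "n = card ?T" using Suc.hyps(2) Suc.prems(1) v by simp
    show "cycle_free E ?T" using Suc.prems(2) cycle_free_subset by blast
  qed (use Suc.prems in auto)
  \<comment> \<open>The case \<open>u\<close> outside \<open>?T\<close> covers an isolated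
    \<open>v\<close>; the intersection is then empty, which also counts as connected.\<close>
  have "K v \<inter> (\<Union>w\<in>?T. K w) = (if u \<in> ?T then K v \<inter> K u else {})"
  proof -
    have "K v \<inter> K w = {}" if "w \<in> ?T" "w \<noteq> u" for w
      using leaf Suc.prems(6)[OF v] that by blast
    then show ?thesis by (cases "u \<in> ?T") auto
  qed
  then have "connected (K v \<inter> (\<Union>w\<in>?T. K w))"
    using Suc.prems(5) v by auto
  moreover have "closed (\<Union>w\<in>?T. K w)"
    using Suc.prems(1,3) by (intro closed_UN) (auto simp: compact_imp_closed)
  ultimately have "connected_component (- (K v \<union> (\<Union>w\<in>?T. K w))) x y"
    using IH Suc.prems(3,4) v by (intro Janiszewski) auto
  moreover have "K v \<union> (\<Union>w\<in>?T. K w) = (\<Union>w\<in>S. K w)" using v by blast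
  ultimately show ?case by simp
qed

text \<open>Points of two pieces are joined by passing, along a walk in the graph, through common
  points of consecutive pieces.\<close>

lemma connected_graph_Union:
  assumes "\<And>v. v \<in> S \<Longrightarrow> connected (K v)"
    and "\<And>v w. \<lbrakk>v \<in> S; w \<in> S; E v w\<rbrakk> \<Longrightarrow> K v \<inter> K w \<noteq> {}"
    and reach: "\<And>v w. \<lbrakk>v \<in> S; w \<in> S\<rbrakk> \<Longrightarrow> (v, w) \<in> {(x, y). x \<in> S \<and> y \<in> S \<and> E x y}\<^sup>*"
  shows "connected (\<Union>v\<in>S. K v)"
proof -
  let ?U = "\<Union>v\<in>S. K v"
  have piece: "connected_component ?U p q" if "v \<in> S" "p \<in> K v" "q \<in> K v" for v p q
    unfolding connected_component_def using that assms(1) by blast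
  have "\<forall>p\<in>K v. \<forall>q\<in>K w. connected_component ?U p q"
    if "v \<in> S" "(v, w) \<in> {(x, y). x \<in> S \<and> y \<in> S \<and> E x y}\<^sup>*" for v w
    using that(2)
  proof (induction rule: rtrancl_induct)
    case base
    then show ?case using piece \<open>v \<in> S\<close> by blast
  next
    case (step w w')
    then have "w \<in> S" "w' \<in> S" "E w w'" by auto
    then obtain r where "r \<in> K w" "r \<in> K w'" using assms(2) by blast
    then show ?case
      using step.IH piece \<open>w' \<in> S\<close> by (meson connected_component_trans)
  qed
  then show ?thesis
    using reach by (auto simp: connected_iff_connected_component)
qed

section \<open>Limit sets in integer coordinates\<close>

text \<open>Cells are pairs (column, row); the sequences here are indexed from 0, and the plane is
  \<^typ>\<open>complex\<close>, where Janiszewski's theorem is available.\<close>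

definition cell_map :: "nat \<Rightarrow> nat \<times> nat \<Rightarrow> complex \<Rightarrow> complex" where
  "cell_map m v z = (z + Complex (real (fst v)) (real (snd v))) / of_nat m"

definition unit_cell :: "complex set" where
  "unit_cell = {z. 0 \<le> Re z \<and> Re z \<le> 1 \<and> 0 \<le> Im z \<and> Im z \<le> 1}"

text \<open>The recursion splits off the first pattern and shifts both sequences, so inductions on
  \<open>n\<close> must keep \<open>m\<close> and \<open>a\<close> arbitrary. Level 0 is the whole
  unit square.\<close>

primrec level :: "nat \<Rightarrow> (nat \<Rightarrow> nat) \<Rightarrow> (nat \<Rightarrow> (nat \<times> nat) set) \<Rightarrow> complex set" where
  "level 0 m a = unit_cell"
| "level (Suc n) m a = (\<Union>v\<in>a 0. cell_map (m 0) v ` level n (m \<circ> Suc) (a \<circ> Suc))"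

definition limit :: "(nat \<Rightarrow> nat) \<Rightarrow> (nat \<Rightarrow> (nat \<times> nat) set) \<Rightarrow> complex set" where
  "limit m a = (\<Inter>n. level n m a)"

definition adjacent :: "nat \<times> nat \<Rightarrow> nat \<times> nat \<Rightarrow> bool" where
  "adjacent v w \<longleftrightarrow>
     fst v = fst w \<and> (snd w = Suc (snd v) \<or> snd v = Suc (snd w)) \<or>
     snd v = snd w \<and> (fst w = Suc (fst v) \<or> fst v = Suc (fst w))"

text \<open>Kept apart from the tree condition: the arguments about sides, corners and intersections
  of copies rest on this part, and it is invariant under transposition.\<close>

definition exits :: "nat \<Rightarrow> (nat \<times> nat) set \<Rightarrow> bool" where
  "exits m a \<longleftrightarrow> 3 \<le> m \<and> a \<subseteq> {..<m} \<times> {..<m} \<and>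
     (\<exists>!i. (i, 0) \<in> a \<and> (i, m - 1) \<in> a) \<and> (\<exists>!j. (0, j) \<in> a \<and> (m - 1, j) \<in> a) \<and>
     \<not> ((0, 0) \<in> a \<and> (m - 1, m - 1) \<in> a) \<and> \<not> ((0, m - 1) \<in> a \<and> (m - 1, 0) \<in> a)"

definition labyrinth :: "nat \<Rightarrow> (nat \<times> nat) set \<Rightarrow> bool" where
  "labyrinth m a \<longleftrightarrow> exits m a \<and> cycle_free adjacent a \<and>
     (\<forall>v\<in>a. \<forall>w\<in>a. (v, w) \<in> {(x, y). x \<in> a \<and> y \<in> a \<and> adjacent x y}\<^sup>*)"

lemma adjacent_sym: "adjacent v w \<Longrightarrow> adjacent w v"
  by (auto simp: adjacent_def)

lemma exits_finite: "exits m a \<Longrightarrow> finite a"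
  unfolding exits_def by (meson finite_SigmaI finite_lessThan finite_subset)

lemma exits_width: "exits m a \<Longrightarrow> 3 \<le> m"
  by (simp add: exits_def)

lemma exits_bounds: "exits m a \<Longrightarrow> v \<in> a \<Longrightarrow> fst v < m \<and> snd v < m"
  by (auto simp: exits_def)

lemma cell_map_sel [simp]:
  "Re (cell_map m v z) = (Re z + fst v) / m" "Im (cell_map m v z) = (Im z + snd v) / m"
  by (simp_all add: cell_map_def)

lemma cell_map_eq_iff:
  "0 < m \<Longrightarrow> cell_map m v p = cell_map m w q \<longleftrightarrow>
     Re p + fst v = Re q + fst w \<and> Im p + snd v = Im q + snd w"
  by (simp add: complex_eq_iff)

lemma dist_cell_map: "dist (cell_map m v p) (cell_map m v q) = dist p q / m"
  by (simp add: cell_map_def dist_norm norm_divide flip: diff_divide_distrib)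

lemma inj_cell_map: "0 < m \<Longrightarrow> inj (cell_map m v)"
  by (auto simp: inj_def cell_map_eq_iff complex_eq_iff)

lemma continuous_cell_map: "continuous_on S (cell_map m v)"
proof (cases "m = 0")
  case False
  then show ?thesis unfolding cell_map_def by (intro continuous_intros) auto
qed (simp add: cell_map_def)

text \<open>Applied to both coordinates, this decides how two cells can share a point. The offsets
  differ by at most one because \<open>x - y\<close> lies between -1 and 1.\<close>

lemma shared_coordinate:
  fixes x y :: real
  assumes "x + real i = y + real k" "0 \<le> x" "x \<le> 1" "0 \<le> y" "y \<le> 1"
  shows "i = k \<and> x = y \<or> k = Suc i \<and> x = 1 \<and> y = 0 \<or> i = Suc k \<and> x = 0 \<and> y = 1"
proof -
  have "i = k \<or> k = Suc i \<or> i = Suc k" using assms by linarith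
  then show ?thesis using assms by auto
qed

lemma unit_cell_box: "unit_cell = cbox 0 (Complex 1 1)"
  by (auto simp: unit_cell_def in_cbox_complex_iff)

lemma compact_unit_cell: "compact unit_cell" and convex_unit_cell: "convex unit_cell"
  by (simp_all add: unit_cell_box compact_cbox convex_box)

lemma cell_map_unit:
  assumes "i < m" "j < m"
  shows "cell_map m (i, j) ` unit_cell \<subseteq> unit_cell"
proof -
  have "1 + real i \<le> m" "1 + real j \<le> m" using assms by linarith+
  then show ?thesis using assms by (auto simp: unit_cell_def divide_simps)
qed

lemma compact_level: "(\<And>k. exits (m k) (a k)) \<Longrightarrow> compact (level n m a)"
proof (induction n arbitrary: m a)
  case 0
  then show ?case by (simp add: compact_unit_cell)
next
  case (Suc n)
  have "compact (level n (m \<circ> Suc) (a \<circ> Suc))" using Suc by simp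
  then show ?case
    using Suc.prems exits_finite
    by (auto intro!: compact_continuous_image continuous_cell_map)
qed

lemma level_Suc_subset: "(\<And>k. exits (m k) (a k)) \<Longrightarrow> level (Suc n) m a \<subseteq> level n m a"
proof (induction n arbitrary: m a)
  case 0
  have "cell_map (m 0) v ` unit_cell \<subseteq> unit_cell" if "v \<in> a 0" for v
    using cell_map_unit[of "fst v" "m 0" "snd v"] exits_bounds[OF 0 that] by simp
  then show ?case by (simp add: UN_subset_iff)
next
  case (Suc n)
  have "level (Suc n) (m \<circ> Suc) (a \<circ> Suc) \<subseteq> level n (m \<circ> Suc) (a \<circ> Suc)" using Suc.prems by (intro Suc.IH) simp
  then show ?case
    unfolding level.simps(2)[of "Suc n" m a] level.simps(2)[of n m a] by blast
qed

lemma level_antimono: "(\<And>k. exits (m k) (a k)) \<Longrightarrow> n \<le> k \<Longrightarrow> level k m a \<subseteq> level n m a"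
  by (rule lift_Suc_antimono_le[where f = "\<lambda>n. level n m a"]) (use level_Suc_subset in auto)

lemma limit_subset_level: "limit m a \<subseteq> level n m a"
  by (auto simp: limit_def)

lemma limit_subset_unit: "limit m a \<subseteq> unit_cell"
  using limit_subset_level[of m a 0] by simp

lemma compact_limit: "(\<And>k. exits (m k) (a k)) \<Longrightarrow> compact (limit m a)"
  unfolding limit_def using compact_level[of m a] by (intro compact_Inter) auto

text \<open>In the inclusion from left to right, the cell containing the point could depend on the
  level. There are finitely many cells, so one of them serves infinitely many levels, and by
  monotonicity all of them.\<close>

lemma limit_unfold:
  assumes "\<And>k. exits (m k) (a k)"
  shows "limit m a = (\<Union>v\<in>a 0. cell_map (m 0) v ` limit (m \<circ> Suc) (a \<circ> Suc))"
proof
  show "(\<Union>v\<in>a 0. cell_map (m 0) v ` limit (m \<circ> Suc) (a \<circ> Suc)) \<subseteq> limit m a"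
  proof -
    have "(\<Union>v\<in>a 0. cell_map (m 0) v ` limit (m \<circ> Suc) (a \<circ> Suc)) \<subseteq> level (Suc n) m a" for n
      unfolding level.simps by (intro UN_mono image_mono limit_subset_level) simp
    then have "(\<Union>v\<in>a 0. cell_map (m 0) v ` limit (m \<circ> Suc) (a \<circ> Suc)) \<subseteq> level n m a" for n
      using level_Suc_subset[OF assms, of n] by (meson order_trans)
    then show ?thesis unfolding limit_def by (rule INT_greatest)
  qed
  show "limit m a \<subseteq> (\<Union>v\<in>a 0. cell_map (m 0) v ` limit (m \<circ> Suc) (a \<circ> Suc))"
  proof
    fix p assume p: "p \<in> limit m a"
    have "\<exists>v\<in>a 0. p \<in> cell_map (m 0) v ` level n (m \<circ> Suc) (a \<circ> Suc)" for n
      using subsetD[OF limit_subset_level[of m a "Suc n"] p] by (simp only: level.simps UN_iff)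
    then obtain f where f: "\<And>n. f n \<in> a 0" "\<And>n. p \<in> cell_map (m 0) (f n) ` level n (m \<circ> Suc) (a \<circ> Suc)"
      by metis
    have "finite (range f)" using f(1) exits_finite[OF assms] by (meson finite_subset image_subsetI)
    then obtain N where N: "infinite {n. f n = f N}"
      using pigeonhole_infinite[of UNIV f] by auto
    have "0 < m 0" using exits_width[OF assms, of 0] by simp
    \<comment> \<open>Since \<open>cell_map\<close> is injective, this single preimage
      \<open>q\<close> is the one at every level whose chosen cell is \<open>f N\<close>.\<close>
    obtain q where q: "p = cell_map (m 0) (f N) q" using f(2) by blast
    have "q \<in> level n (m \<circ> Suc) (a \<circ> Suc)" for n
    proof -
      obtain k where k: "n < k" "f k = f N" using N by (auto simp: infinite_nat_iff_unbounded)
      then have "q \<in> level k (m \<circ> Suc) (a \<circ> Suc)"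
        using f(2)[of k] q inj_image_mem_iff[OF inj_cell_map[OF \<open>0 < m 0\<close>]] by simp
      then show ?thesis using level_antimono[of "m \<circ> Suc" "a \<circ> Suc" n k] assms k(1) by (simp add: subset_iff)
    qed
    then show "p \<in> (\<Union>v\<in>a 0. cell_map (m 0) v ` limit (m \<circ> Suc) (a \<circ> Suc))"
      using q f(1) unfolding limit_def by blast
  qed
qed


section \<open>Transposition, exchanging left and right with bottom and top\<close>

lemma level_transpose: "z \<in> level n m (\<lambda>k. prod.swap ` a k) \<longleftrightarrow> Complex (Im z) (Re z) \<in> level n m a"
proof (induction n arbitrary: m a z)
  case 0
  then show ?case by (auto simp: unit_cell_def)
next
  case (Suc n)
  have swap: "z = cell_map k (prod.swap v) q \<longleftrightarrow>
      Complex (Im z) (Re z) = cell_map k v (Complex (Im q) (Re q))" for k v q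
    by (auto simp: complex_eq_iff)
  have shift: "(\<lambda>k. prod.swap ` a k) \<circ> Suc = (\<lambda>k. prod.swap ` (a \<circ> Suc) k)" by auto
  have "z \<in> level (Suc n) m (\<lambda>k. prod.swap ` a k) \<longleftrightarrow>
      (\<exists>v\<in>a 0. \<exists>q. z = cell_map (m 0) (prod.swap v) q \<and> q \<in> level n (m \<circ> Suc) ((\<lambda>k. prod.swap ` a k) \<circ> Suc))"
    by (simp only: level.simps UN_iff image_iff bex_simps Bex_def) blast
  also have "\<dots> \<longleftrightarrow> (\<exists>v\<in>a 0. \<exists>q. Complex (Im z) (Re z) = cell_map (m 0) v (Complex (Im q) (Re q))
      \<and> Complex (Im q) (Re q) \<in> level n (m \<circ> Suc) (a \<circ> Suc))"
    unfolding swap shift Suc.IH ..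
  also have "\<dots> \<longleftrightarrow> (\<exists>v\<in>a 0. \<exists>q. Complex (Im z) (Re z) = cell_map (m 0) v q
      \<and> q \<in> level n (m \<circ> Suc) (a \<circ> Suc))"
    by (metis complex.sel complex.collapse)
  also have "\<dots> \<longleftrightarrow> Complex (Im z) (Re z) \<in> level (Suc n) m a"
    by (simp only: level.simps UN_iff image_iff Bex_def) blast
  finally show ?case .
qed

lemma limit_transpose: "z \<in> limit m (\<lambda>k. prod.swap ` a k) \<longleftrightarrow> Complex (Im z) (Re z) \<in> limit m a"
  by (simp add: limit_def level_transpose)

lemma exits_transpose: "exits m a \<Longrightarrow> exits m (prod.swap ` a)"
proof -
  have [simp]: "(i, j) \<in> prod.swap ` a \<longleftrightarrow> (j, i) \<in> a" for i j by force
  assume "exits m a"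
  then show ?thesis unfolding exits_def by auto
qed

section \<open>Points on opposite sides and meeting of adjacent copies\<close>

text \<open>A pair of points at equal height for the shifted sequence is copied into the left and
  the right exit of the first pattern. These exits lie in one row, so the heights remain
  equal.\<close>

lemma level_left_right:
  assumes "\<And>k. exits (m k) (a k)"
  shows "\<exists>y. Complex 0 y \<in> level n m a \<and> Complex 1 y \<in> level n m a"
  using assms
proof (induction n arbitrary: m a)
  case 0
  show ?case by (rule exI[of _ 0]) (simp add: unit_cell_def)
next
  case (Suc n)
  have "\<exists>y. Complex 0 y \<in> level n (m \<circ> Suc) (a \<circ> Suc) \<and> Complex 1 y \<in> level n (m \<circ> Suc) (a \<circ> Suc)"
    using Suc.prems by (intro Suc.IH) simp
  then obtain y where y: "Complex 0 y \<in> level n (m \<circ> Suc) (a \<circ> Suc)" "Complex 1 y \<in> level n (m \<circ> Suc) (a \<circ> Suc)"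
    by blast
  obtain j where j: "(0, j) \<in> a 0" "(m 0 - 1, j) \<in> a 0"
    using Suc.prems[of 0] unfolding exits_def by blast
  have "3 \<le> m 0" using exits_width[OF Suc.prems] .
  then have "Complex 0 ((y + j) / m 0) = cell_map (m 0) (0, j) (Complex 0 y)"
    "Complex 1 ((y + j) / m 0) = cell_map (m 0) (m 0 - 1, j) (Complex 1 y)"
    by (auto simp: complex_eq_iff)
  then show ?case using y j by (intro exI[of _ "(y + j) / m 0"]) auto
qed

lemma level_bottom_top:
  assumes "\<And>k. exits (m k) (a k)"
  shows "\<exists>x. Complex x 0 \<in> level n m a \<and> Complex x 1 \<in> level n m a"
  using level_left_right[of m "\<lambda>k. prod.swap ` a k" n] assms
  by (simp add: level_transpose exits_transpose)

text \<open>The right end of the pair in one cell is the left end of the pair in the next cell;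
  vertical neighbours are treated alike.\<close>

lemma adjacent_levels_meet:
  assumes ex: "\<And>k. exits (m k) (a k)" and "adjacent v w"
  shows "cell_map k v ` level n m a \<inter> cell_map k w ` level n m a \<noteq> {}"
proof -
  have right: "cell_map k (i, j) ` level n m a \<inter> cell_map k (Suc i, j) ` level n m a \<noteq> {}" for i j
  proof -
    obtain y where "Complex 0 y \<in> level n m a" "Complex 1 y \<in> level n m a"
      using level_left_right[of m a n] ex by blast
    moreover have "cell_map k (i, j) (Complex 1 y) = cell_map k (Suc i, j) (Complex 0 y)"
      by (simp add: complex_eq_iff)
    ultimately show ?thesis by (metis IntI empty_iff imageI)
  qed
  have up: "cell_map k (i, j) ` level n m a \<inter> cell_map k (i, Suc j) ` level n m a \<noteq> {}" for i j
  proof -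
    obtain x where "Complex x 0 \<in> level n m a" "Complex x 1 \<in> level n m a"
      using level_bottom_top[of m a n] ex by blast
    moreover have "cell_map k (i, j) (Complex x 1) = cell_map k (i, Suc j) (Complex x 0)"
      by (simp add: complex_eq_iff)
    ultimately show ?thesis by (metis IntI empty_iff imageI)
  qed
  show ?thesis
    using \<open>adjacent v w\<close> right[of "fst v" "snd v"] right[of "fst w" "snd w"]
      up[of "fst v" "snd v"] up[of "fst w" "snd w"]
    unfolding adjacent_def by (metis Int_commute prod.collapse)
qed

section \<open>Connectedness and local connectedness\<close>

lemma labyrinth_exits: "labyrinth m a \<Longrightarrow> exits m a"
  by (simp add: labyrinth_def)

lemma connected_level:
  assumes "\<And>k. labyrinth (m k) (a k)"
  shows "connected (level n m a)"
  using assms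
proof (induction n arbitrary: m a)
  case 0
  then show ?case by (simp add: convex_unit_cell convex_connected)
next
  case (Suc n)
  have "connected (level n (m \<circ> Suc) (a \<circ> Suc))" using Suc.prems by (intro Suc.IH) simp
  then show ?case
    unfolding level.simps
  proof (intro connected_graph_Union[where E = adjacent])
    show "cell_map (m 0) v ` level n (m \<circ> Suc) (a \<circ> Suc) \<inter> cell_map (m 0) w ` level n (m \<circ> Suc) (a \<circ> Suc) \<noteq> {}"
      if "adjacent v w" for v w
      using that Suc.prems by (intro adjacent_levels_meet) (simp_all add: labyrinth_exits)
  qed (use Suc.prems in \<open>auto simp: labyrinth_def intro: connected_continuous_image continuous_cell_map\<close>)
qed

text \<open>A decreasing intersection of compact connected sets is connected.\<close>

lemma connected_limit:
  assumes "\<And>k. labyrinth (m k) (a k)"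
  shows "connected (limit m a)"
  unfolding limit_def
  using assms by (intro connected_nest compact_level connected_level level_antimono labyrinth_exits)

lemma dist_unit_cell: "p \<in> unit_cell \<Longrightarrow> q \<in> unit_cell \<Longrightarrow> dist p q \<le> 2"
  using cmod_le[of "p - q"] by (simp add: unit_cell_def dist_norm abs_le_iff) linarith

text \<open>The pieces are copies of whole limit sets of shifted sequences, hence connected. Each
  level divides distances by a width of at least 3, starting from the crude bound 2 of
  \<open>dist_unit_cell\<close>.\<close>

lemma limit_small_pieces:
  assumes "\<And>k. labyrinth (m k) (a k)"
  shows "\<exists>F. finite F \<and> limit m a = \<Union>F \<and>
    (\<forall>K\<in>F. compact K \<and> connected K \<and> (\<forall>p\<in>K. \<forall>q\<in>K. dist p q \<le> 2 / 3 ^ n))"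
  using assms
proof (induction n arbitrary: m a)
  case 0
  then have "compact (limit m a)" "connected (limit m a)"
    by (simp_all add: compact_limit connected_limit labyrinth_exits)
  then show ?case
    using dist_unit_cell limit_subset_unit[of m a] by (intro exI[of _ "{limit m a}"]) (auto simp: subset_iff)
next
  case (Suc n)
  have ex: "exits (m k) (a k)" for k using Suc.prems labyrinth_exits by blast
  have "\<exists>F. finite F \<and> limit (m \<circ> Suc) (a \<circ> Suc) = \<Union>F \<and>
    (\<forall>K\<in>F. compact K \<and> connected K \<and> (\<forall>p\<in>K. \<forall>q\<in>K. dist p q \<le> 2 / 3 ^ n))"
    using Suc.prems by (intro Suc.IH) simp
  then obtain F where F: "finite F" "limit (m \<circ> Suc) (a \<circ> Suc) = \<Union>F"
    "\<forall>K\<in>F. compact K \<and> connected K \<and> (\<forall>p\<in>K. \<forall>q\<in>K. dist p q \<le> 2 / 3 ^ n)"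
    by blast
  let ?G = "\<Union>v\<in>a 0. (\<lambda>K. cell_map (m 0) v ` K) ` F"
  show ?case
  proof (intro exI[of _ ?G] conjI ballI)
    show "finite ?G" using F(1) exits_finite[OF ex] by blast
    show "limit m a = \<Union>?G" unfolding limit_unfold[of m a, OF ex] F(2) by auto
    fix L assume "L \<in> ?G"
    then obtain v K where L: "L = cell_map (m 0) v ` K" "K \<in> F" by auto
    show "compact L" "connected L"
      using bspec[OF F(3) L(2)] unfolding L(1)
      by (auto intro: compact_continuous_image connected_continuous_image continuous_cell_map)
    fix p' q' assume "p' \<in> L" "q' \<in> L"
    then obtain p q where pq: "p \<in> K" "q \<in> K" "p' = cell_map (m 0) v p" "q' = cell_map (m 0) v q"
      using L by auto
    have "dist p' q' = dist p q / m 0" unfolding pq dist_cell_map ..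
    also have "\<dots> \<le> (2 / 3 ^ n) / 3"
      using bspec[OF F(3) L(2)] pq exits_width[OF ex, of 0] by (intro frac_le) auto
    finally show "dist p' q' \<le> 2 / 3 ^ Suc n" by (simp add: mult.commute)
  qed
qed

text \<open>By the im kleinen characterisation, the connected set joining \<open>x\<close> to a
  nearby \<open>y\<close> need not be open; one small piece containing both points is
  enough.\<close>

lemma locally_connected_space_small_pieces:
  fixes S :: "'a::metric_space set"
  assumes "\<And>e. 0 < e \<Longrightarrow> \<exists>F. finite F \<and> S = \<Union>F \<and>
    (\<forall>K\<in>F. closed K \<and> connected K \<and> (\<forall>p\<in>K. \<forall>q\<in>K. dist p q < e))"
  shows "locally_connected_space (top_of_set S)"
  unfolding locally_connected_space_im_kleinen
proof (intro allI impI, elim conjE)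
  fix V x assume V: "openin (top_of_set S) V" "x \<in> V"
  then obtain e where e: "0 < e" "ball x e \<inter> S \<subseteq> V"
    by (metis openin_contains_ball)
  obtain F where F: "finite F" "S = \<Union>F"
    "\<And>K. K \<in> F \<Longrightarrow> closed K \<and> connected K \<and> (\<forall>p\<in>K. \<forall>q\<in>K. dist p q < e)"
    using assms[OF e(1)] by auto
  \<comment> \<open>Only finitely many closed pieces are removed, so \<open>?U\<close> is relatively
    open, and every piece through a point of \<open>?U\<close> contains \<open>x\<close>.\<close>
  let ?U = "S - \<Union>{K \<in> F. x \<notin> K}"
  have "closed (\<Union>{K \<in> F. x \<notin> K})" using F by (intro closed_Union) auto
  then have "openin (top_of_set S) ?U" by (simp add: Diff_eq openin_open_Int open_Compl)
  moreover have "x \<in> ?U" using V openin_imp_subset by blast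
  moreover have "\<exists>C. connectedin (top_of_set S) C \<and> C \<subseteq> V \<and> x \<in> C \<and> y \<in> C" if y: "y \<in> ?U" for y
  proof -
    obtain K where K: "K \<in> F" "y \<in> K" "x \<in> K" using y F(2) by blast
    moreover have "K \<subseteq> ball x e" using F(3) K by auto
    moreover have "K \<subseteq> S" using F(2) K by blast
    ultimately show ?thesis using e(2) F(3)[of K] by (intro exI[of _ K]) (auto simp: connectedin_subtopology)
  qed
  moreover from this have "?U \<subseteq> V" by blast
  ultimately show "\<exists>U. openin (top_of_set S) U \<and> x \<in> U \<and> U \<subseteq> V \<and>
      (\<forall>y\<in>U. \<exists>C. connectedin (top_of_set S) C \<and> C \<subseteq> V \<and> x \<in> C \<and> y \<in> C)"
    by (intro exI[of _ ?U]) blast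
qed

lemma locally_connected_limit:
  assumes "\<And>k. labyrinth (m k) (a k)"
  shows "locally_connected_space (top_of_set (limit m a))"
proof (rule locally_connected_space_small_pieces)
  fix e :: real assume "0 < e"
  then obtain n where "(1 / 3) ^ n < e / 2"
    using real_arch_pow_inv[of "e / 2" "1 / 3"] by auto
  then have n: "2 / 3 ^ n < e" by (simp add: power_one_over field_simps)
  obtain F where "finite F" "limit m a = \<Union>F"
    "\<forall>K\<in>F. compact K \<and> connected K \<and> (\<forall>p\<in>K. \<forall>q\<in>K. dist p q \<le> 2 / 3 ^ n)"
    using limit_small_pieces[of m a n, OF assms] by blast
  then show "\<exists>F. finite F \<and> limit m a = \<Union>F \<and>
      (\<forall>K\<in>F. closed K \<and> connected K \<and> (\<forall>p\<in>K. \<forall>q\<in>K. dist p q < e))"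
    using n by (meson compact_imp_closed order_le_less_trans)
qed


section \<open>Pieces of the limit set\<close>

lemma limit_piece:
  assumes "\<And>k. exits (m k) (a k)" "z \<in> limit m a"
  obtains v p where "v \<in> a 0" "p \<in> limit (m \<circ> Suc) (a \<circ> Suc)" "z = cell_map (m 0) v p"
  using assms(2) limit_unfold[of m a, OF assms(1)] by blast

text \<open>Locates a point on a side of the unit square: its cell lies along that side, and its
  preimage lies on the same side of the unit square.\<close>

lemma boundary_coordinate:
  fixes x :: real
  assumes "0 \<le> x" "x \<le> 1" "i < m"
  shows "(x + real i) / real m = 0 \<longleftrightarrow> i = 0 \<and> x = 0"
    and "(x + real i) / real m = 1 \<longleftrightarrow> i = m - 1 \<and> x = 1"
proof -
  have *: "real i + 1 \<le> real m" using assms by linarith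
  then show "(x + real i) / real m = 0 \<longleftrightarrow> i = 0 \<and> x = 0" using assms by auto
  have "x + real i = real m \<longleftrightarrow> Suc i = m \<and> x = 1" using assms * by linarith
  then show "(x + real i) / real m = 1 \<longleftrightarrow> i = m - 1 \<and> x = 1" using assms by auto
qed

text \<open>A corner of the unit square in the limit set forces the corresponding corner cell of the
  first pattern to be white, so the condition on opposite corners applies.\<close>

lemma limit_corners:
  assumes ex: "\<And>k. exits (m k) (a k)"
  shows "\<not> (Complex 0 0 \<in> limit m a \<and> Complex 1 1 \<in> limit m a)"
    and "\<not> (Complex 0 1 \<in> limit m a \<and> Complex 1 0 \<in> limit m a)"
proof -
  \<comment> \<open>The coordinates 0 and 1 correspond to the cell indices 0 and
    \<open>m 0 - 1\<close>.\<close>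
  have corner: "(if x = 0 then 0 else m 0 - 1, if y = 0 then 0 else m 0 - 1) \<in> a 0"
    if xy: "Complex x y \<in> limit m a" "x \<in> {0, 1}" "y \<in> {0, 1}" for x y
  proof -
    obtain v p where v: "v \<in> a 0" "p \<in> limit (m \<circ> Suc) (a \<circ> Suc)" "Complex x y = cell_map (m 0) v p"
      using limit_piece[OF ex xy(1)] by blast
    moreover have "p \<in> unit_cell" using v(2) limit_subset_unit by blast
    moreover note exits_bounds[OF ex v(1)]
    ultimately show ?thesis
      using xy(2,3) boundary_coordinate[of "Re p" "fst v" "m 0"] boundary_coordinate[of "Im p" "snd v" "m 0"]
      by (cases v) (auto simp: complex_eq_iff unit_cell_def)
  qed
  show "\<not> (Complex 0 0 \<in> limit m a \<and> Complex 1 1 \<in> limit m a)"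
    "\<not> (Complex 0 1 \<in> limit m a \<and> Complex 1 0 \<in> limit m a)"
    using corner[of 0 0] corner[of 1 1] corner[of 0 1] corner[of 1 0] ex[of 0] by (auto simp: exits_def)
qed

text \<open>A height at which both vertical sides meet the limit set lies in the unique exit row of the first
  pattern: two different rows would produce diagonally opposite corners one level further down.\<close>

lemma limit_left_right_descend:
  assumes ex: "\<And>k. exits (m k) (a k)"
    and y: "Complex 0 y \<in> limit m a" "Complex 1 y \<in> limit m a"
  obtains j t where "(0, j) \<in> a 0" "(m 0 - 1, j) \<in> a 0" "y = (t + real j) / real (m 0)"
    "Complex 0 t \<in> limit (m \<circ> Suc) (a \<circ> Suc)" "Complex 1 t \<in> limit (m \<circ> Suc) (a \<circ> Suc)"
proof -
  let ?L = "limit (m \<circ> Suc) (a \<circ> Suc)"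
  obtain v p where v: "v \<in> a 0" "p \<in> ?L" "Complex 0 y = cell_map (m 0) v p"
    using limit_piece[OF ex y(1)] by blast
  obtain w q where w: "w \<in> a 0" "q \<in> ?L" "Complex 1 y = cell_map (m 0) w q"
    using limit_piece[OF ex y(2)] by blast
  have pq: "p \<in> unit_cell" "q \<in> unit_cell" using v(2) w(2) limit_subset_unit by auto
  have bd: "fst v < m 0" "fst w < m 0" using exits_bounds[OF ex v(1)] exits_bounds[OF ex w(1)] by auto
  have "(Re p + fst v) / m 0 = 0" "(Re q + fst w) / m 0 = 1"
    using arg_cong[OF v(3), of Re] arg_cong[OF w(3), of Re] by simp_all
  then have l: "fst v = 0" "Re p = 0" and r: "fst w = m 0 - 1" "Re q = 1"
    using pq bd boundary_coordinate(1)[of "Re p" "fst v" "m 0"] boundary_coordinate(2)[of "Re q" "fst w" "m 0"]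
    by (simp_all add: unit_cell_def)
  have "0 < m 0" using bd by simp
  then have eq: "Im p + snd v = Im q + snd w"
    using arg_cong[OF v(3), of Im] arg_cong[OF w(3), of Im] by simp
  have corners: "\<not> (Complex 0 0 \<in> ?L \<and> Complex 1 1 \<in> ?L)" "\<not> (Complex 0 1 \<in> ?L \<and> Complex 1 0 \<in> ?L)"
    using limit_corners[of "m \<circ> Suc" "a \<circ> Suc"] ex by simp_all
  have "p = Complex 0 (Im p)" "q = Complex 1 (Im q)" using l r by (simp_all add: complex_eq_iff)
  then have mem: "Complex 0 (Im p) \<in> ?L" "Complex 1 (Im q) \<in> ?L" using v w by metis+
  have "snd v = snd w \<and> Im p = Im q"
    using shared_coordinate[OF eq] pq mem corners by (auto simp: unit_cell_def)
  then have same: "snd w = snd v" "Im q = Im p" by simp_all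
  show thesis
  proof (rule that)
    show "(0, snd v) \<in> a 0" using v(1) l(1) by (metis prod.collapse)
    show "(m 0 - 1, snd v) \<in> a 0" using w(1) r(1) same(1) by (metis prod.collapse)
    show "y = (Im p + real (snd v)) / real (m 0)" using arg_cong[OF v(3), of Im] by simp
    show "Complex 0 (Im p) \<in> ?L" "Complex 1 (Im p) \<in> ?L" using mem same(2) by simp_all
  qed
qed

text \<open>Two such heights lie in the same exit row at every level of the descent, and each level
  divides their difference by at least 3.\<close>

lemma limit_left_right_unique:
  assumes ex: "\<And>k. exits (m k) (a k)"
    and "Complex 0 y \<in> limit m a" "Complex 1 y \<in> limit m a"
    and "Complex 0 y' \<in> limit m a" "Complex 1 y' \<in> limit m a"
  shows "y = y'"
proof -
  have "\<bar>y - y'\<bar> \<le> (1 / 3) ^ n" for n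
    using assms
  proof (induction n arbitrary: m a y y')
    case 0
    then have "Complex 0 y \<in> unit_cell" "Complex 0 y' \<in> unit_cell" using limit_subset_unit by blast+
    then show ?case by (simp add: unit_cell_def abs_le_iff)
  next
    case (Suc n)
    let ?L = "limit (m \<circ> Suc) (a \<circ> Suc)"
    obtain j t where j: "(0, j) \<in> a 0" "(m 0 - 1, j) \<in> a 0" "y = (t + real j) / real (m 0)"
      and t: "Complex 0 t \<in> ?L" "Complex 1 t \<in> ?L"
      using limit_left_right_descend[OF Suc.prems(1-3)] .
    obtain j' t' where j': "(0, j') \<in> a 0" "(m 0 - 1, j') \<in> a 0" "y' = (t' + real j') / real (m 0)"
      and t': "Complex 0 t' \<in> ?L" "Complex 1 t' \<in> ?L"
      using limit_left_right_descend[OF Suc.prems(1,4,5)] .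
    have "j = j'" using Suc.prems(1)[of 0] j j' unfolding exits_def by blast
    have "\<bar>t - t'\<bar> \<le> (1 / 3) ^ n" using Suc.prems(1) by (intro Suc.IH[OF _ t t']) simp
    then have "\<bar>t - t'\<bar> / m 0 \<le> (1 / 3) ^ n / 3"
      using exits_width[OF Suc.prems(1), of 0] by (intro frac_le) auto
    moreover have "\<bar>y - y'\<bar> = \<bar>t - t'\<bar> / m 0"
      unfolding j j' \<open>j = j'\<close> by (simp flip: diff_divide_distrib)
    ultimately show ?case by simp
  qed
  moreover have "(\<lambda>n. (1 / 3 :: real) ^ n) \<longlonglongrightarrow> 0" by (rule LIMSEQ_realpow_zero) auto
  ultimately have "\<bar>y - y'\<bar> \<le> 0" by (intro LIMSEQ_le_const) auto
  then show ?thesis by simp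
qed

lemma limit_bottom_top_unique:
  assumes "\<And>k. exits (m k) (a k)"
    and "Complex x 0 \<in> limit m a" "Complex x 1 \<in> limit m a"
    and "Complex x' 0 \<in> limit m a" "Complex x' 1 \<in> limit m a"
  shows "x = x'"
  using limit_left_right_unique[of m "\<lambda>k. prod.swap ` a k" x x'] assms
  by (simp add: limit_transpose exits_transpose)

text \<open>Distinct cells that are not adjacent share at most a corner. A common point there would
  come from two opposite corners of the unit square, both in the limit set, against
  \<open>limit_corners\<close>.\<close>

lemma limit_pieces_disjoint:
  assumes ex: "\<And>k. exits (m k) (a k)" and "0 < k" "v \<noteq> w" "\<not> adjacent v w"
  shows "cell_map k v ` limit m a \<inter> cell_map k w ` limit m a = {}"
proof (rule ccontr)
  assume "cell_map k v ` limit m a \<inter> cell_map k w ` limit m a \<noteq> {}"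
  then obtain p q where "p \<in> limit m a" "q \<in> limit m a" "cell_map k v p = cell_map k w q" by blast
  moreover obtain x y x' y' where "p = Complex x y" "q = Complex x' y'" by (metis complex.exhaust)
  ultimately have mem: "Complex x y \<in> limit m a" "Complex x' y' \<in> limit m a"
    and cells: "cell_map k v (Complex x y) = cell_map k w (Complex x' y')" by simp_all
  then have eq: "x + fst v = x' + fst w" "y + snd v = y' + snd w"
    using \<open>0 < k\<close> by (auto simp: cell_map_eq_iff)
  have "Complex x y \<in> unit_cell" "Complex x' y' \<in> unit_cell" using mem limit_subset_unit by auto
  with shared_coordinate[OF eq(1)] shared_coordinate[OF eq(2)] mem limit_corners[of m a, OF ex] assms(3,4)
  show False by (auto simp: unit_cell_def adjacent_def prod_eq_iff)
qed

text \<open>A common point lies on the side shared by two adjacent cells, so it comes from a point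
  of the limit set whose partner straight across, on the opposite side, also belongs to it. Such a
  pair is unique.\<close>

lemma limit_pieces_meet_once:
  assumes ex: "\<And>k. exits (m k) (a k)" and "0 < k" "v \<noteq> w"
    and z: "z \<in> cell_map k v ` limit m a \<inter> cell_map k w ` limit m a"
    and z': "z' \<in> cell_map k v ` limit m a \<inter> cell_map k w ` limit m a"
  shows "z = z'"
proof -
  have right: "z = z'"
    if z: "z \<in> cell_map k (i, j) ` limit m a" "z \<in> cell_map k (Suc i, j) ` limit m a"
      and z': "z' \<in> cell_map k (i, j) ` limit m a" "z' \<in> cell_map k (Suc i, j) ` limit m a" for z z' i j
  proof -
    have "\<exists>y. z = cell_map k (i, j) (Complex 1 y) \<and> Complex 1 y \<in> limit m a \<and> Complex 0 y \<in> limit m a"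
      if z: "z \<in> cell_map k (i, j) ` limit m a" "z \<in> cell_map k (Suc i, j) ` limit m a" for z
    proof -
      obtain p q where pq: "p \<in> limit m a" "q \<in> limit m a" "z = cell_map k (i, j) p" "z = cell_map k (Suc i, j) q"
        using z by blast
      then have "Re p = Re q + 1" "Im p = Im q" using \<open>0 < k\<close> by (auto simp: cell_map_eq_iff)
      moreover have "p \<in> unit_cell" "q \<in> unit_cell" using pq limit_subset_unit by auto
      ultimately have "p = Complex 1 (Im p)" "q = Complex 0 (Im p)"
        by (auto simp: unit_cell_def complex_eq_iff)
      then show ?thesis using pq by metis
    qed
    then show ?thesis using limit_left_right_unique[of m a, OF ex] z z' by metis
  qed
  have up: "z = z'"
    if z: "z \<in> cell_map k (i, j) ` limit m a" "z \<in> cell_map k (i, Suc j) ` limit m a"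
      and z': "z' \<in> cell_map k (i, j) ` limit m a" "z' \<in> cell_map k (i, Suc j) ` limit m a" for z z' i j
  proof -
    have "\<exists>x. z = cell_map k (i, j) (Complex x 1) \<and> Complex x 1 \<in> limit m a \<and> Complex x 0 \<in> limit m a"
      if z: "z \<in> cell_map k (i, j) ` limit m a" "z \<in> cell_map k (i, Suc j) ` limit m a" for z
    proof -
      obtain p q where pq: "p \<in> limit m a" "q \<in> limit m a" "z = cell_map k (i, j) p" "z = cell_map k (i, Suc j) q"
        using z by blast
      then have "Im p = Im q + 1" "Re p = Re q" using \<open>0 < k\<close> by (auto simp: cell_map_eq_iff)
      moreover have "p \<in> unit_cell" "q \<in> unit_cell" using pq limit_subset_unit by auto
      ultimately have "p = Complex (Re p) 1" "q = Complex (Re p) 0"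
        by (auto simp: unit_cell_def complex_eq_iff)
      then show ?thesis using pq by metis
    qed
    then show ?thesis using limit_bottom_top_unique[of m a, OF ex] z z' by metis
  qed
  \<comment> \<open>The four orientations of an adjacent pair reduce to \<open>right\<close> and
    \<open>up\<close> by exchanging \<open>v\<close> and \<open>w\<close>.\<close>
  have "adjacent v w"
    using limit_pieces_disjoint[of m a k v w, OF ex \<open>0 < k\<close> \<open>v \<noteq> w\<close>] z by blast
  then show ?thesis
    using z z' right[of z "fst v" "snd v" z'] right[of z "fst w" "snd w" z']
      up[of z "fst v" "snd v" z'] up[of z "fst w" "snd w" z']
    unfolding adjacent_def by (metis IntE prod.collapse)
qed

section \<open>The complement of the limit set\<close>

lemma connected_component_image:
  assumes "connected_component S x y" "continuous_on S f" "f ` S \<subseteq> T"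
  shows "connected_component T (f x) (f y)"
  using assms unfolding connected_component_def
  by (meson connected_continuous_image continuous_on_subset image_eqI image_mono order_trans subsetD)

text \<open>Taking the points off a fixed level gives the induction its base, the complement of a
  bounded convex set. In the step, pulling the points back along any one cell map puts them off
  level \<open>n\<close> of the shifted sequence.\<close>

lemma limit_not_separating:
  assumes "\<And>k. labyrinth (m k) (a k)" "x \<notin> level n m a" "y \<notin> level n m a"
  shows "connected_component (- limit m a) x y"
  using assms
proof (induction n arbitrary: m a x y)
  case 0
  have "connected (- unit_cell)"
    using compact_unit_cell convex_unit_cell
    by (intro connected_complement_bounded_convex) (simp_all add: compact_imp_bounded)
  then show ?case
    using 0 limit_subset_unit[of m a] unfolding connected_component_def
    by (intro exI[of _ "- unit_cell"]) auto
next
  case (Suc n)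
  have ex: "exits (m k) (a k)" for k using Suc.prems labyrinth_exits by blast
  have ex': "exits ((m \<circ> Suc) k) ((a \<circ> Suc) k)" for k using ex by simp
  have m0: "0 < m 0" using exits_width[OF ex, of 0] by simp
  let ?L = "limit (m \<circ> Suc) (a \<circ> Suc)"
  have "connected_component (- (\<Union>v\<in>a 0. cell_map (m 0) v ` ?L)) x y"
  proof (rule forest_not_separating[where E = adjacent])
    show "finite (a 0)" using exits_finite[OF ex] .
    show "cycle_free adjacent (a 0)" using Suc.prems(1)[of 0] by (simp add: labyrinth_def)
    show "compact (cell_map (m 0) v ` ?L)" for v
      using compact_limit[of "m \<circ> Suc" "a \<circ> Suc", OF ex'] by (intro compact_continuous_image continuous_cell_map)
    show "connected_component (- (cell_map (m 0) v ` ?L)) x y" if v: "v \<in> a 0" for v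
    proof -
      \<comment> \<open>The inverse of \<open>cell_map (m 0) v\<close> on the whole plane;
        \<open>g x\<close> and \<open>g y\<close> may well lie outside the unit square.\<close>
      define g where "g z = of_nat (m 0) * z - Complex (fst v) (snd v)" for z
      have g: "cell_map (m 0) v (g z) = z" for z using m0 by (simp add: g_def cell_map_def)
      have "g x \<notin> level n (m \<circ> Suc) (a \<circ> Suc)" "g y \<notin> level n (m \<circ> Suc) (a \<circ> Suc)"
        using Suc.prems(2,3) v g unfolding level.simps by (metis UN_I imageI)+
      then have "connected_component (- ?L) (g x) (g y)"
        using Suc.prems(1) by (intro Suc.IH) simp
      then have "connected_component (- (cell_map (m 0) v ` ?L)) (cell_map (m 0) v (g x)) (cell_map (m 0) v (g y))"
        by (rule connected_component_image[OF _ continuous_cell_map])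
          (auto dest: injD[OF inj_cell_map[OF m0]])
      then show ?thesis by (simp add: g)
    qed
    show "connected (cell_map (m 0) v ` ?L \<inter> cell_map (m 0) w ` ?L)" if "v \<noteq> w" for v w
    proof -
      let ?S = "cell_map (m 0) v ` ?L \<inter> cell_map (m 0) w ` ?L"
      have "p = q" if "p \<in> ?S" "q \<in> ?S" for p q
        using limit_pieces_meet_once[of "m \<circ> Suc" "a \<circ> Suc", OF ex' m0 \<open>v \<noteq> w\<close> that] .
      then have "?S = {} \<or> (\<exists>p. ?S = {p})" by blast
      then show ?thesis by (metis connected_empty connected_sing)
    qed
    show "cell_map (m 0) v ` ?L \<inter> cell_map (m 0) w ` ?L = {}" if "v \<noteq> w" "\<not> adjacent v w" for v w
      using limit_pieces_disjoint[of "m \<circ> Suc" "a \<circ> Suc", OF ex' m0 that] .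
  qed (rule adjacent_sym)
  then show ?case using limit_unfold[of m a, OF ex] by simp
qed

text \<open>Each point of the complement is off some level, and since the levels decrease, two
  points are off a common one.\<close>

lemma connected_Compl_limit:
  assumes lab: "\<And>k. labyrinth (m k) (a k)"
  shows "connected (- limit m a)"
proof -
  have "connected_component (- limit m a) x y" if xy: "x \<notin> limit m a" "y \<notin> limit m a" for x y
  proof -
    obtain i j where "x \<notin> level i m a" "y \<notin> level j m a" using xy by (auto simp: limit_def)
    moreover have "level (max i j) m a \<subseteq> level i m a" "level (max i j) m a \<subseteq> level j m a"
      by (rule level_antimono; simp add: lab labyrinth_exits)+
    ultimately show ?thesis using limit_not_separating[of m a, OF lab] by blast
  qed
  then show ?thesis by (simp add: connected_iff_connected_component)
qed

section \<open>Density of the complement\<close>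

definition open_cell :: "complex set" where
  "open_cell = {z. 0 < Re z \<and> Re z < 1 \<and> 0 < Im z \<and> Im z < 1}"

text \<open>A point in the interior of a cell belongs to no other cell, since sharing would need a
  coordinate 0 or 1. Membership in the limit set can therefore be tested in a single copy.\<close>

lemma open_cell_map_eq:
  assumes "cell_map k v p = cell_map k w q" "0 < k" "p \<in> open_cell" "q \<in> unit_cell"
  shows "v = w \<and> p = q"
proof -
  have eq: "Re p + fst v = Re q + fst w" "Im p + snd v = Im q + snd w"
    using assms by (auto simp: cell_map_eq_iff)
  show ?thesis
    using shared_coordinate[OF eq(1)] shared_coordinate[OF eq(2)] assms(3,4)
    by (auto simp: open_cell_def unit_cell_def complex_eq_iff prod_eq_iff)
qed

lemma open_cell_map_limit:
  assumes "\<And>k. exits (m k) (a k)" "p \<in> open_cell" "cell_map (m 0) v p \<in> limit m a"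
  shows "v \<in> a 0 \<and> p \<in> limit (m \<circ> Suc) (a \<circ> Suc)"
proof -
  obtain w q where "w \<in> a 0" "q \<in> limit (m \<circ> Suc) (a \<circ> Suc)" "cell_map (m 0) v p = cell_map (m 0) w q"
    using limit_piece[OF assms(1,3)] by metis
  moreover have "0 < m 0" using exits_width[OF assms(1), of 0] by simp
  ultimately show ?thesis using open_cell_map_eq assms(2) limit_subset_unit by blast
qed

lemma cell_map_open_cell:
  assumes "p \<in> open_cell" "fst v < m" "snd v < m"
  shows "cell_map m v p \<in> open_cell"
proof -
  have "1 + real (fst v) \<le> m" "1 + real (snd v) \<le> m" using assms by linarith+
  then show ?thesis using assms by (auto simp: open_cell_def divide_simps)
qed

lemma open_cell_subset_unit: "open_cell \<subseteq> unit_cell"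
  by (auto simp: open_cell_def unit_cell_def)

text \<open>One of two opposite corner cells is black, and its centre is off the limit set. Copying
  such a point into the cells around \<open>p\<close> brings it closer by a factor of at least 3 per
  level; asking for \<open>q\<close> in \<open>open_cell\<close> keeps the copies off the limit
  set.\<close>

lemma Compl_limit_near_point:
  assumes "\<And>k. exits (m k) (a k)" "p \<in> limit m a"
  shows "\<exists>q\<in>open_cell. q \<notin> limit m a \<and> dist q p \<le> 2 / 3 ^ n"
  using assms
proof (induction n arbitrary: m a p)
  case 0
  have "(0, 0) \<notin> a 0 \<or> (m 0 - 1, m 0 - 1) \<notin> a 0" using 0(1)[of 0] by (auto simp: exits_def)
  moreover have "0 < m 0" using exits_width[OF 0(1), of 0] by simp
  ultimately obtain v where v: "v \<notin> a 0" "fst v < m 0" "snd v < m 0"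
    by (metis diff_less fst_conv less_numeral_extra(1) snd_conv)
  let ?c = "Complex (1 / 2) (1 / 2)"
  have c: "?c \<in> open_cell" by (simp add: open_cell_def)
  have "cell_map (m 0) v ?c \<notin> limit m a" using open_cell_map_limit[of m a, OF 0(1) c] v by blast
  moreover have q: "cell_map (m 0) v ?c \<in> open_cell" using cell_map_open_cell c v by blast
  moreover have "dist (cell_map (m 0) v ?c) p \<le> 2"
    using dist_unit_cell q 0(2) open_cell_subset_unit limit_subset_unit by blast
  ultimately show ?case by auto
next
  case (Suc n)
  have m0: "3 \<le> m 0" using exits_width[OF Suc.prems(1)] .
  obtain v p' where v: "v \<in> a 0" "p' \<in> limit (m \<circ> Suc) (a \<circ> Suc)" "p = cell_map (m 0) v p'"
    using limit_piece[OF Suc.prems] by metis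
  have "\<exists>q\<in>open_cell. q \<notin> limit (m \<circ> Suc) (a \<circ> Suc) \<and> dist q p' \<le> 2 / 3 ^ n"
    using Suc.prems(1) v(2) by (intro Suc.IH) simp
  then obtain q where q: "q \<in> open_cell" "q \<notin> limit (m \<circ> Suc) (a \<circ> Suc)" "dist q p' \<le> 2 / 3 ^ n" by blast
  have "cell_map (m 0) v q \<notin> limit m a" using open_cell_map_limit[of m a, OF Suc.prems(1) q(1)] q(2) by blast
  moreover have "cell_map (m 0) v q \<in> open_cell"
    using cell_map_open_cell q(1) exits_bounds[OF Suc.prems(1) v(1)] by blast
  moreover have "dist q p' / m 0 \<le> (2 / 3 ^ n) / 3" using q(3) m0 by (intro frac_le) auto
  then have "dist (cell_map (m 0) v q) p \<le> 2 / 3 ^ Suc n"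
    by (simp add: v(3) dist_cell_map mult.commute)
  ultimately show ?case by blast
qed

lemma closure_Compl_limit:
  assumes "\<And>k. exits (m k) (a k)"
  shows "closure (- limit m a) = UNIV"
proof -
  have "p \<in> closure (- limit m a)" if p: "p \<in> limit m a" for p
    unfolding closure_approachable
  proof (intro allI impI)
    fix e :: real assume "0 < e"
    then obtain n where "(1 / 3) ^ n < e / 2"
      using real_arch_pow_inv[of "e / 2" "1 / 3"] by auto
    then have "2 / 3 ^ n < e" by (simp add: power_one_over field_simps)
    moreover obtain q where "q \<notin> limit m a" "dist q p \<le> 2 / 3 ^ n"
      using Compl_limit_near_point[of m a p n, OF assms p] by blast
    ultimately show "\<exists>q\<in>- limit m a. dist q p < e" by force
  qed
  then show ?thesis using closure_subset by blast
qed

section \<open>Absence of simple closed curves\<close>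

lemma homeomorphic_space_imp_homeomorphic:
  assumes "top_of_set S homeomorphic_space top_of_set T"
  shows "S homeomorphic T"
proof -
  obtain f g where fg: "homeomorphic_maps (top_of_set S) (top_of_set T) f g"
    using assms unfolding homeomorphic_space_def by blast
  then have f: "continuous_on S f" "f ` S \<subseteq> T" "\<forall>x\<in>S. g (f x) = x"
    and g: "continuous_on T g" "g ` T \<subseteq> S" "\<forall>y\<in>T. f (g y) = y"
    by (auto simp: homeomorphic_maps_def continuous_map_in_subtopology)
  have "f ` S = T" "g ` T = S" using f g by force+
  then have "homeomorphism S T f g" using f g by (simp add: homeomorphism_def)
  then show ?thesis unfolding homeomorphic_def by blast
qed

text \<open>The set \<open>- C\<close> lies between the connected set \<open>- S\<close> and its
  closure, so it is connected, whereas the complement of a simple closed curve in the plane is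
  not.\<close>

lemma connected_dense_Compl_no_circle:
  fixes S C :: "complex set"
  assumes "connected (- S)" "closure (- S) = UNIV" "C \<subseteq> S"
  shows "\<not> C homeomorphic sphere (0::complex) 1"
proof
  assume "C homeomorphic sphere (0::complex) 1"
  then have "\<not> connected (- C)" by (rule Jordan_Brouwer_separation) simp
  moreover have "connected (- C)"
    by (rule connected_intermediate_closure[OF assms(1)]) (use assms in auto)
  ultimately show False by blast
qed

lemma dendrite_limit:
  assumes "\<And>k. labyrinth (m k) (a k)"
  shows "dendrite (top_of_set (limit m a))"
  unfolding dendrite_def continuum_def
proof (intro conjI)
  have ex: "exits (m k) (a k)" for k using assms labyrinth_exits by blast
  show "compact_space (top_of_set (limit m a))"
    using compact_limit[of m a, OF ex] by (simp add: compact_space_subtopology)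
  show "connected_space (top_of_set (limit m a))"
    using connected_limit[of m a, OF assms] by (simp add: connected_space_subtopology)
  show "Hausdorff_space (top_of_set (limit m a))"
    by (simp add: Hausdorff_space_subtopology)
  show "locally_connected_space (top_of_set (limit m a))"
    by (rule locally_connected_limit[OF assms])
  show "\<nexists>C. simple_closed_curve_in (top_of_set (limit m a)) C"
  proof (rule notI, elim exE)
    fix C assume "simple_closed_curve_in (top_of_set (limit m a)) C"
    then have "C \<subseteq> limit m a" "top_of_set C homeomorphic_space top_of_set (sphere (0::complex) 1)"
      by (auto simp: simple_closed_curve_in_def subtopology_subtopology Int_absorb1)
    moreover from this have "C homeomorphic sphere (0::complex) 1"
      by (simp add: homeomorphic_space_imp_homeomorphic)
    ultimately show False
      using connected_dense_Compl_no_circle connected_Compl_limit[of m a, OF assms] closure_Compl_limit[of m a, OF ex]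
      by blast
  qed
qed


section \<open>From patterns to integer coordinates\<close>

definition cells :: "nat \<Rightarrow> plane set set \<Rightarrow> (nat \<times> nat) set" where
  "cells m A = {(i, j). i < m \<and> j < m \<and> grid_square i j m \<in> A}"

definition to_plane :: "complex \<Rightarrow> plane" where
  "to_plane z = (Re z, Im z)"

lemma grid_square_Times:
  "grid_square i j m = {real i / m..(real i + 1) / m} \<times> {real j / m..(real j + 1) / m}"
  by (auto simp: grid_square_def)

lemma grid_square_eq_square: "grid_square i j m = square (real i / m) (real j / m) (1 / m)"
  by (simp add: grid_square_Times square_def add_divide_distrib)

lemma square_eq_iff:
  assumes "0 < q" "0 < q'"
  shows "square x y q = square x' y' q' \<longleftrightarrow> x = x' \<and> y = y' \<and> q = q'"
  using assms by (auto simp: square_def times_eq_iff Icc_eq_Icc)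

lemma grid_square_eq_iff:
  assumes "0 < m"
  shows "grid_square i j m = grid_square k l m \<longleftrightarrow> i = k \<and> j = l"
  using assms by (simp add: grid_square_eq_square square_eq_iff)

lemma quadruples_meet_iff:
  "{a, b, c, d} \<inter> {a', b', c', d'} \<noteq> {} \<longleftrightarrow>
     a = a' \<or> a = b' \<or> a = c' \<or> a = d' \<or> b = a' \<or> b = b' \<or> b = c' \<or> b = d' \<or>
     c = a' \<or> c = b' \<or> c = c' \<or> c = d' \<or> d = a' \<or> d = b' \<or> d = c' \<or> d = d'"
  by blast

text \<open>Sides are nondegenerate segments, so a horizontal one never equals a vertical one, and
  equality of parallel sides is a comparison of integer indices.\<close>

lemma grid_sides_meet_iff:
  assumes "0 < m"
  shows "(i, j) \<noteq> (k, l) \<and> grid_sides i j m \<inter> grid_sides k l m \<noteq> {} \<longleftrightarrow> adjacent (i, j) (k, l)"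
proof -
  have lt: "real n / m < (real n + 1) / m" for n using assms by (simp add: divide_strict_right_mono)
  have side: "{x} \<times> {b..t} = {x'} \<times> {b'..t'} \<longleftrightarrow> x = x' \<and> b = b' \<and> t = t'"
    "{b..t} \<times> {x} = {b'..t'} \<times> {x'} \<longleftrightarrow> x = x' \<and> b = b' \<and> t = t'"
    "{x} \<times> {b..t} \<noteq> {b'..t'} \<times> {x'}"
    if "b < t" "b' < t'" for x b t x' b' t' :: real
    using that atLeastAtMost_singleton_iff[of b' t' x]
    by (simp_all add: times_eq_iff Icc_eq_Icc) (metis less_irrefl)+
  have eq: "real n / m = real n' / m \<longleftrightarrow> n = n'"
    "(real n + 1) / m = (real n' + 1) / m \<longleftrightarrow> n = n'"
    "real n / m = (real n' + 1) / m \<longleftrightarrow> n = Suc n'"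
    "(real n + 1) / m = real n' / m \<longleftrightarrow> Suc n = n'" for n n'
    using assms by auto
  have mixed: "{x} \<times> {b..t} = {b'..t'} \<times> {x'} \<longleftrightarrow> False" "{b'..t'} \<times> {x'} = {x} \<times> {b..t} \<longleftrightarrow> False"
    if "b < t" "b' < t'" for x b t x' b' t' :: real
    using side(3)[OF that] by metis+
  show ?thesis
    unfolding grid_sides_def Let_def quadruples_meet_iff side(1,2)[OF lt lt] mixed[OF lt lt] eq adjacent_def
    by auto
qed

lemma pattern_graph_edge_iff:
  assumes "0 < m" "v \<in> cells m A" "w \<in> cells m A"
  shows "{grid_square (fst v) (snd v) m, grid_square (fst w) (snd w) m} \<in> snd (pattern_graph m A)
    \<longleftrightarrow> adjacent v w"
proof
  assume "{grid_square (fst v) (snd v) m, grid_square (fst w) (snd w) m} \<in> snd (pattern_graph m A)"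
  then obtain i j k l where
    edge: "{grid_square (fst v) (snd v) m, grid_square (fst w) (snd w) m} = {grid_square i j m, grid_square k l m}
      \<and> i < m \<and> j < m \<and> k < m \<and> l < m \<and> grid_square i j m \<in> A \<and> grid_square k l m \<in> A
      \<and> grid_square i j m \<noteq> grid_square k l m \<and> grid_sides i j m \<inter> grid_sides k l m \<noteq> {}"
    unfolding pattern_graph_def snd_conv mem_Collect_eq by (elim exE) (rule that)
  then have eq: "{grid_square (fst v) (snd v) m, grid_square (fst w) (snd w) m} = {grid_square i j m, grid_square k l m}"
    by (rule conjunct1)
  have "grid_square i j m \<noteq> grid_square k l m" and sides: "grid_sides i j m \<inter> grid_sides k l m \<noteq> {}"
    using edge by simp_all
  then have "(i, j) \<noteq> (k, l)" by (simp add: grid_square_eq_iff[OF assms(1)])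
  with sides have "adjacent (i, j) (k, l)"
    using grid_sides_meet_iff[OF assms(1), of i j k l] by simp
  \<comment> \<open>An edge is an unordered pair, so its two squares may appear in either
    order.\<close>
  moreover have "v = (i, j) \<and> w = (k, l) \<or> v = (k, l) \<and> w = (i, j)"
    using eq unfolding doubleton_eq_iff grid_square_eq_iff[OF assms(1)] by (simp add: prod_eq_iff)
  ultimately show "adjacent v w" using adjacent_sym by blast
next
  assume "adjacent v w"
  then have "(fst v, snd v) \<noteq> (fst w, snd w)" "grid_sides (fst v) (snd v) m \<inter> grid_sides (fst w) (snd w) m \<noteq> {}"
    using grid_sides_meet_iff[OF assms(1), of "fst v" "snd v" "fst w" "snd w"] by simp_all
  moreover from this have "grid_square (fst v) (snd v) m \<noteq> grid_square (fst w) (snd w) m"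
    using grid_square_eq_iff[OF assms(1)] by (metis prod.collapse)
  ultimately show "{grid_square (fst v) (snd v) m, grid_square (fst w) (snd w) m} \<in> snd (pattern_graph m A)"
    using assms unfolding pattern_graph_def snd_conv cells_def
    by (intro CollectI exI[of _ "fst v"] exI[of _ "snd v"] exI[of _ "fst w"] exI[of _ "snd w"])
      (simp add: split_beta)
qed

lemma pattern_eq_image_cells:
  assumes "A \<subseteq> grid_squares m"
  shows "A = (\<lambda>v. grid_square (fst v) (snd v) m) ` cells m A"
  using assms by (force simp: grid_squares_def cells_def)

lemma ex1_image_inj: "inj f \<Longrightarrow> \<exists>!y. y \<in> f ` S \<Longrightarrow> \<exists>!x. x \<in> S"
  unfolding inj_def by (metis imageE imageI)

text \<open>For \<open>0 < m\<close> a grid square determines its indices, so exit pairs, cycles and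
  walks of squares correspond to those of cells.\<close>

lemma labyrinth_cells:
  assumes "labyrinth_pattern m A"
  shows "labyrinth m (cells m A)"
proof -
  let ?g = "\<lambda>v. grid_square (fst v) (snd v) m" and ?G = "pattern_graph m A" and ?C = "cells m A"
  have m: "3 \<le> m" "0 < m" and A: "A = ?g ` ?C"
    using assms by (auto simp: labyrinth_pattern_def pattern_def intro!: pattern_eq_image_cells)
  have tree: "ugraph_connected ?G" "\<nexists>xs. ugraph_cycle ?G xs"
    using assms by (auto simp: labyrinth_pattern_def ugraph_tree_def)
  have fstG: "fst ?G = A" by (simp add: pattern_graph_def)
  have "\<exists>!i. (i, 0) \<in> ?C \<and> (i, m - 1) \<in> ?C"
  proof -
    have "\<exists>!p. p \<in> vertical_exit_pairs m A" using assms by (simp add: labyrinth_pattern_def)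
    moreover have "vertical_exit_pairs m A =
        (\<lambda>i. (grid_square i (m - 1) m, grid_square i 0 m)) ` {i. (i, 0) \<in> ?C \<and> (i, m - 1) \<in> ?C}"
      using m by (auto simp: vertical_exit_pairs_def cells_def)
    moreover have "inj (\<lambda>i. (grid_square i (m - 1) m, grid_square i 0 m))" by (auto simp: inj_def grid_square_eq_iff[OF m(2)])
    ultimately show ?thesis using ex1_image_inj by (metis (no_types, lifting) mem_Collect_eq)
  qed
  moreover have "\<exists>!j. (0, j) \<in> ?C \<and> (m - 1, j) \<in> ?C"
  proof -
    have "\<exists>!p. p \<in> horizontal_exit_pairs m A" using assms by (simp add: labyrinth_pattern_def)
    moreover have "horizontal_exit_pairs m A =
        (\<lambda>j. (grid_square 0 j m, grid_square (m - 1) j m)) ` {j. (0, j) \<in> ?C \<and> (m - 1, j) \<in> ?C}"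
      using m by (auto simp: horizontal_exit_pairs_def cells_def)
    moreover have "inj (\<lambda>j. (grid_square 0 j m, grid_square (m - 1) j m))" by (auto simp: inj_def grid_square_eq_iff[OF m(2)])
    ultimately show ?thesis using ex1_image_inj by (metis (no_types, lifting) mem_Collect_eq)
  qed
  moreover have "\<not> ((0, 0) \<in> ?C \<and> (m - 1, m - 1) \<in> ?C)" "\<not> ((0, m - 1) \<in> ?C \<and> (m - 1, 0) \<in> ?C)"
    using assms by (auto simp: labyrinth_pattern_def cells_def)
  ultimately have "exits m ?C"
    using m by (auto simp: exits_def cells_def)
  moreover have "cycle_free adjacent ?C"
    unfolding cycle_free_def
  proof (rule notI, elim exE conjE)
    fix xs
    assume xs: "3 \<le> length xs" "distinct xs" "set xs \<subseteq> ?C"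
      "\<forall>i<length xs. adjacent (xs ! i) (xs ! (Suc i mod length xs))"
    have "inj_on ?g (set xs)"
      by (auto simp: inj_on_def grid_square_eq_iff[OF m(2)] prod_eq_iff)
    moreover have "{map ?g xs ! i, map ?g xs ! (Suc i mod length (map ?g xs))} \<in> snd ?G"
      if "i < length (map ?g xs)" for i
    proof -
      have "0 < length xs" using xs(1) by linarith
      then have i: "i < length xs" "Suc i mod length xs < length xs"
        using that mod_less_divisor[of "length xs" "Suc i"] by simp_all
      then have "xs ! i \<in> ?C" "xs ! (Suc i mod length xs) \<in> ?C"
        using xs(3) by (auto intro: subsetD[OF _ nth_mem])
      then show ?thesis
        using pattern_graph_edge_iff[OF m(2)] xs(4) i by simp
    qed
    moreover have "set (map ?g xs) \<subseteq> A" using xs(3) by (auto simp: cells_def)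
    ultimately have "ugraph_cycle ?G (map ?g xs)"
      using xs(1,2) unfolding ugraph_cycle_def fstG by (simp add: distinct_map)
    then show False using tree(2) by blast
  qed
  moreover have "(v, w) \<in> {(x, y). x \<in> ?C \<and> y \<in> ?C \<and> adjacent x y}\<^sup>*"
    if v: "v \<in> ?C" and w: "w \<in> ?C" for v w
  proof -
    have "(?g v, ?g w) \<in> {(x, y). {x, y} \<in> snd ?G}\<^sup>*"
      using tree(1) v w unfolding ugraph_connected_def fstG by (auto simp: cells_def)
    \<comment> \<open>The walk of squares is lifted step by step to a walk of cells, carrying along
      the cell \<open>u\<close> of the square reached so far.\<close>
    then have "\<exists>u\<in>?C. ?g w = ?g u \<and> (v, u) \<in> {(x, y). x \<in> ?C \<and> y \<in> ?C \<and> adjacent x y}\<^sup>*"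
    proof (induction rule: rtrancl_induct)
      case base
      then show ?case using v by blast
    next
      case (step y z)
      then obtain u where u: "u \<in> ?C" "y = ?g u" "(v, u) \<in> {(x, y). x \<in> ?C \<and> y \<in> ?C \<and> adjacent x y}\<^sup>*"
        by blast
      have "z \<in> A" using step.hyps(2) by (auto simp: pattern_graph_def doubleton_eq_iff)
      then obtain u' where u': "u' \<in> ?C" "z = ?g u'" using A by blast
      have "adjacent u u'"
        using pattern_graph_edge_iff[OF m(2) u(1) u'(1)] step.hyps(2) u(2) u'(2) by simp
      then have "(v, u') \<in> {(x, y). x \<in> ?C \<and> y \<in> ?C \<and> adjacent x y}\<^sup>*"
        using u(1) u'(1) by (intro rtrancl_into_rtrancl[OF u(3)]) simp
      then show ?case using u' by blast
    qed
    then show ?thesis unfolding grid_square_eq_iff[OF m(2)] prod_eq_iff[symmetric] by blast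
  qed
  ultimately show ?thesis by (simp add: labyrinth_def)
qed

section \<open>Comparison of the two subdivision recursions\<close>

lemma square_map_square:
  assumes "0 < q"
  shows "square_map x y q ` square x' y' q' = square (q * x' + x) (q * y' + y) (q * q')"
proof -
  have "(\<lambda>t. q * t + c) ` {u..u + q'} = {q * u + c..q * u + c + q * q'}" for u c
  proof (cases "0 \<le> q'")
    case True
    then show ?thesis
      using image_affinity_atLeastAtMost[of q c u "u + q'"] assms by (simp add: algebra_simps)
  next
    \<comment> \<open>A negative \<open>q'\<close> makes both intervals empty.\<close>
    case False
    then show ?thesis using assms by (simp add: mult_pos_neg)
  qed
  moreover have "square_map x y q ` (S \<times> T) = (\<lambda>t. q * t + x) ` S \<times> (\<lambda>t. q * t + y) ` T" for S T
    unfolding square_map_def by force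
  ultimately show ?thesis by (simp add: square_def)
qed

lemma inj_square_map: "0 < q \<Longrightarrow> inj (square_map x y q)"
  by (auto simp: inj_def square_map_def)

lemma square_map_comp:
  "square_map x y q ` square_map x' y' q' ` W = square_map (q * x' + x) (q * y' + y) (q * q') ` W"
  by (auto simp: square_map_def image_image algebra_simps split_beta)

text \<open>The definition subdivides the squares of the last level; here the first pattern is split off
  instead, which is what the recursion of \<^const>\<open>level\<close> needs.\<close>

lemma white_squares_shift:
  "white_squares A (Suc (Suc n)) =
     {square_map x y q ` W | W x y q.
        W \<in> white_squares (\<lambda>k. A (Suc k)) (Suc n) \<and> 0 < q \<and> square x y q \<in> A 1}"
proof (induction n)
  case 0
  show ?case by (simp add: numeral_2_eq_2)
next
  case (Suc n)
  let ?B = "\<lambda>k. A (Suc k)"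
  have sq: "0 < q \<and> square x y q \<in> white_squares A (Suc (Suc n)) \<longleftrightarrow>
      (\<exists>x1 y1 q1 x2 y2 q2. 0 < q1 \<and> 0 < q2 \<and> square x1 y1 q1 \<in> A 1 \<and>
        square x2 y2 q2 \<in> white_squares ?B (Suc n) \<and>
        x = q1 * x2 + x1 \<and> y = q1 * y2 + y1 \<and> q = q1 * q2)" (is "?l \<longleftrightarrow> ?r")
    for x y q
  proof
    assume l: ?l
    then obtain x1 y1 q1 W where W: "square x y q = square_map x1 y1 q1 ` W"
      "W \<in> white_squares ?B (Suc n)" "0 < q1" "square x1 y1 q1 \<in> A 1"
      unfolding Suc.IH by blast
    \<comment> \<open>The affine map is solved for the inner square: being the preimage of a square,
      \<open>W\<close> is itself a square, with these parameters.\<close>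
    have "square_map x1 y1 q1 ` square ((x - x1) / q1) ((y - y1) / q1) (q / q1) = square_map x1 y1 q1 ` W"
      unfolding W(1)[symmetric] square_map_square[OF W(3)] using W(3) by simp
    then have "square ((x - x1) / q1) ((y - y1) / q1) (q / q1) = W"
      using inj_image_eq_iff[OF inj_square_map[OF W(3)]] by metis
    then have "square ((x - x1) / q1) ((y - y1) / q1) (q / q1) \<in> white_squares ?B (Suc n)"
      using W(2) by simp
    moreover have "x = q1 * ((x - x1) / q1) + x1" "y = q1 * ((y - y1) / q1) + y1" "q = q1 * (q / q1)" "0 < q / q1"
      using l W(3) by simp_all
    ultimately show ?r using W(3,4) by blast
  next
    assume ?r
    then obtain x1 y1 q1 x2 y2 q2 where h: "0 < q1" "0 < q2" "square x1 y1 q1 \<in> A 1"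
      "square x2 y2 q2 \<in> white_squares ?B (Suc n)" "x = q1 * x2 + x1" "y = q1 * y2 + y1" "q = q1 * q2"
      by blast
    then have "square x y q = square_map x1 y1 q1 ` square x2 y2 q2" by (simp add: square_map_square)
    moreover have "0 < q" using h by simp
    ultimately show ?l unfolding Suc.IH using h(1,3,4) by blast
  qed
  show ?case
  proof (rule set_eqI)
    fix S
    have "S \<in> white_squares A (Suc (Suc (Suc n))) \<longleftrightarrow>
        (\<exists>W x y q. S = square_map x y q ` W \<and> W \<in> A (Suc (Suc (Suc n))) \<and> 0 < q \<and>
          square x y q \<in> white_squares A (Suc (Suc n)))"
      unfolding white_squares.simps(3)[of A "Suc n"] by blast
    also have "\<dots> \<longleftrightarrow> (\<exists>W x1 y1 q1 x2 y2 q2. S = square_map x1 y1 q1 ` square_map x2 y2 q2 ` W \<and>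
        W \<in> A (Suc (Suc (Suc n))) \<and> 0 < q1 \<and> 0 < q2 \<and> square x1 y1 q1 \<in> A 1 \<and>
        square x2 y2 q2 \<in> white_squares ?B (Suc n))"
      unfolding square_map_comp sq by blast
    also have "\<dots> \<longleftrightarrow> S \<in> {square_map x y q ` W | W x y q.
        W \<in> white_squares ?B (Suc (Suc n)) \<and> 0 < q \<and> square x y q \<in> A 1}"
      unfolding white_squares.simps(3)[of ?B n] by blast
    finally show "S \<in> white_squares A (Suc (Suc (Suc n))) \<longleftrightarrow> S \<in> {square_map x y q ` W | W x y q.
        W \<in> white_squares ?B (Suc (Suc n)) \<and> 0 < q \<and> square x y q \<in> A 1}" .
  qed
qed

lemma to_plane_cell_map:
  "to_plane (cell_map m v z) = square_map (real (fst v) / m) (real (snd v) / m) (1 / m) (to_plane z)"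
  by (simp add: to_plane_def square_map_def add_divide_distrib)

lemma to_plane_unit_cell: "to_plane ` unit_cell = square 0 0 1"
proof -
  have "(x, y) \<in> to_plane ` unit_cell" if "(x, y) \<in> square 0 0 1" for x y
    using that by (intro image_eqI[of _ _ "Complex x y"]) (auto simp: to_plane_def unit_cell_def square_def)
  then show ?thesis by (auto simp: to_plane_def unit_cell_def square_def)
qed

lemma to_plane_cell:
  assumes "0 < m"
  shows "to_plane ` cell_map m v ` unit_cell = grid_square (fst v) (snd v) m"
  using square_map_square[of "1 / m" "real (fst v) / m" "real (snd v) / m" 0 0 1] assms
  by (simp add: image_image to_plane_cell_map grid_square_eq_square flip: to_plane_unit_cell)

text \<open>Stated from \<open>Suc n\<close> on because \<open>level_set A 0\<close> is empty, while
  \<open>level 0\<close> is the unit square.\<close>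

lemma level_set_eq_level:
  assumes "\<And>k. 1 \<le> k \<Longrightarrow> 0 < m k" "\<And>k. 1 \<le> k \<Longrightarrow> A k \<subseteq> grid_squares (m k)"
  shows "level_set A (Suc n) = to_plane ` level (Suc n) (\<lambda>k. m (Suc k)) (\<lambda>k. cells (m (Suc k)) (A (Suc k)))"
  using assms
proof (induction n arbitrary: A m)
  case 0
  have "A 1 = (\<lambda>v. grid_square (fst v) (snd v) (m 1)) ` cells (m 1) (A 1)"
    using 0 by (intro pattern_eq_image_cells) simp
  then have "\<Union> (A 1) = (\<Union>v\<in>cells (m 1) (A 1). to_plane ` cell_map (m 1) v ` unit_cell)"
    using to_plane_cell[of "m 1"] 0(1)[of 1] by simp
  then show ?case by (simp add: level_set_def image_UN)
next
  case (Suc n)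
  let ?B = "\<lambda>k. A (Suc k)" and ?m = "\<lambda>k. m (Suc k)"
  let ?L = "level (Suc n) (\<lambda>k. ?m (Suc k)) (\<lambda>k. cells (?m (Suc k)) (?B (Suc k)))"
  have m1: "0 < m 1" using Suc.prems(1)[of 1] by simp
  have IH: "level_set ?B (Suc n) = to_plane ` ?L"
    using Suc.prems by (intro Suc.IH) auto
  \<comment> \<open>A nondegenerate square determines its corner and side length, so the parameters
    range exactly over the white cells of the first pattern.\<close>
  have sq: "0 < q \<and> square x y q \<in> A 1 \<longleftrightarrow>
      (\<exists>v\<in>cells (m 1) (A 1). x = real (fst v) / m 1 \<and> y = real (snd v) / m 1 \<and> q = 1 / m 1)" for x y q
  proof
    assume q: "0 < q \<and> square x y q \<in> A 1"
    have "A 1 \<subseteq> (\<lambda>v. grid_square (fst v) (snd v) (m 1)) ` cells (m 1) (A 1)"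
      using Suc.prems(2) by (intro equalityD1[OF pattern_eq_image_cells]) simp
    with q obtain v where v: "v \<in> cells (m 1) (A 1)" "square x y q = grid_square (fst v) (snd v) (m 1)"
      by blast
    show "\<exists>v\<in>cells (m 1) (A 1). x = real (fst v) / m 1 \<and> y = real (snd v) / m 1 \<and> q = 1 / m 1"
    proof (intro bexI[OF _ v(1)])
      have "square x y q = square (fst v / m 1) (snd v / m 1) (1 / m 1)"
        using v(2) by (simp only: grid_square_eq_square)
      then show "x = real (fst v) / m 1 \<and> y = real (snd v) / m 1 \<and> q = 1 / m 1"
        using q m1 by (simp add: square_eq_iff)
    qed
  next
    assume "\<exists>v\<in>cells (m 1) (A 1). x = real (fst v) / m 1 \<and> y = real (snd v) / m 1 \<and> q = 1 / m 1"
    then show "0 < q \<and> square x y q \<in> A 1"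
      using m1 by (auto simp: cells_def grid_square_eq_square)
  qed
  have "level_set A (Suc (Suc n)) =
      (\<Union>v\<in>cells (m 1) (A 1). square_map (real (fst v) / m 1) (real (snd v) / m 1) (1 / m 1) ` level_set ?B (Suc n))"
    unfolding level_set_def white_squares_shift sq by blast
  also have "\<dots> = (\<Union>v\<in>cells (m 1) (A 1). to_plane ` cell_map (m 1) v ` ?L)"
    unfolding IH by (simp add: image_image to_plane_cell_map)
  also have "\<dots> = to_plane ` level (Suc (Suc n)) ?m (\<lambda>k. cells (?m k) (?B k))"
    by (subst (2) level.simps) (simp add: image_UN comp_def)
  finally show ?case .
qed

lemma inj_to_plane: "inj to_plane"
  by (auto simp: inj_def to_plane_def complex_eq_iff)

lemma limit_set_eq_limit:
  assumes "\<And>k. 1 \<le> k \<Longrightarrow> labyrinth_pattern (m k) (A k)"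
  shows "limit_set A = to_plane ` limit (\<lambda>k. m (Suc k)) (\<lambda>k. cells (m (Suc k)) (A (Suc k)))"
proof -
  let ?m = "\<lambda>k. m (Suc k)" and ?a = "\<lambda>k. cells (m (Suc k)) (A (Suc k))"
  have m: "0 < m k" "A k \<subseteq> grid_squares (m k)" if "1 \<le> k" for k
    using assms[OF that] by (auto simp: labyrinth_pattern_def pattern_def)
  have ex: "exits (?m k) (?a k)" for k
    using labyrinth_cells[OF assms] by (simp add: labyrinth_exits)
  have "{1..} = range Suc"
    by (auto simp: image_iff) (metis Suc_le_D)
  then have "limit_set A = (\<Inter>n. level_set A (Suc n))" by (simp add: limit_set_def)
  also have "\<dots> = (\<Inter>n. to_plane ` level (Suc n) ?m ?a)"
    using level_set_eq_level[of m A, OF m] by simp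
  \<comment> \<open>Injectivity of \<open>to_plane\<close> lets the image commute with the
    intersection.\<close>
  also have "\<dots> = to_plane ` (\<Inter>n. level (Suc n) ?m ?a)"
    using image_INT[of to_plane UNIV UNIV "\<lambda>n. level (Suc n) ?m ?a"] inj_to_plane by simp
  \<comment> \<open>Level 0 contains level 1, so including it leaves the intersection
    unchanged.\<close>
  also have "(\<Inter>n. level (Suc n) ?m ?a) = limit ?m ?a"
    using level_Suc_subset[of ?m ?a, OF ex] unfolding limit_def by blast
  finally show ?thesis .
qed

section \<open>Transfer to the real plane\<close>

lemma homeomorphic_dendrite:
  assumes XY: "X homeomorphic_space Y" and "dendrite X"
  shows "dendrite Y"
proof -
  have "simple_closed_curve_in X (g ` C)"
    if g: "homeomorphic_map Y X g" and C: "simple_closed_curve_in Y C" for g C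
  proof -
    have sub: "C \<subseteq> topspace Y" "g ` topspace Y = topspace X"
      using C g by (auto simp: simple_closed_curve_in_def homeomorphic_imp_surjective_map)
    then have "homeomorphic_map (subtopology Y C) (subtopology X (g ` C)) g"
      by (intro homeomorphic_map_subtopologies[OF g]) auto
    then have "subtopology X (g ` C) homeomorphic_space subtopology Y C"
      using homeomorphic_map_imp_homeomorphic_space homeomorphic_space_sym by blast
    then show ?thesis
      using C sub homeomorphic_space_trans unfolding simple_closed_curve_in_def by blast
  qed
  moreover obtain g where "homeomorphic_map Y X g"
    using XY homeomorphic_space homeomorphic_space_sym by blast
  ultimately have "\<nexists>C. simple_closed_curve_in Y C"
    using \<open>dendrite X\<close> unfolding dendrite_def by blast
  then show ?thesis
    using assms homeomorphic_compact_space[OF XY] homeomorphic_connected_space[OF XY]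
      homeomorphic_Hausdorff_space[OF XY] homeomorphic_locally_connected_space[OF XY]
    unfolding dendrite_def continuum_def by blast
qed

lemma homeomorphic_space_to_plane: "top_of_set S homeomorphic_space top_of_set (to_plane ` S)"
proof -
  let ?g = "\<lambda>p. Complex (fst p) (snd p)"
  have "continuous_on S to_plane"
    unfolding to_plane_def by (intro continuous_intros)
  moreover have "continuous_on (to_plane ` S) ?g"
    unfolding Complex_eq by (intro continuous_intros)
  ultimately have "homeomorphic_maps (top_of_set S) (top_of_set (to_plane ` S)) to_plane ?g"
    by (auto simp: homeomorphic_maps_def continuous_map_in_subtopology to_plane_def)
  then show ?thesis unfolding homeomorphic_space_def by blast
qed

theorem theorem1:
  fixes A :: "nat \<Rightarrow> plane set set" and m :: "nat \<Rightarrow> nat"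
  assumes "\<And>k. 1 \<le> k \<Longrightarrow> 3 \<le> m k"
    and "\<And>k. 1 \<le> k \<Longrightarrow> labyrinth_pattern (m k) (A k)"
  shows "dendrite (top_of_set (limit_set A))"
proof -
  \<comment> \<open>The given sequences start at index 1, those of \<open>limit\<close> at index
    0.\<close>
  have "dendrite (top_of_set (limit (\<lambda>k. m (Suc k)) (\<lambda>k. cells (m (Suc k)) (A (Suc k)))))"
    using assms(2) by (intro dendrite_limit labyrinth_cells) simp
  then have "dendrite (top_of_set (to_plane ` limit (\<lambda>k. m (Suc k)) (\<lambda>k. cells (m (Suc k)) (A (Suc k)))))"
    by (rule homeomorphic_dendrite[OF homeomorphic_space_to_plane])
  moreover have "limit_set A = to_plane ` limit (\<lambda>k. m (Suc k)) (\<lambda>k. cells (m (Suc k)) (A (Suc k)))"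
    using assms(2) by (rule limit_set_eq_limit)
  ultimately show ?thesis by simp
qed

end
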